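(* Specifying a model of the theory $\mathbb{T}_\Sigma$ of natural models admitting dependent sum types is equivalent to specifying a natural model $(\mathbb{C},p:\dot{\mathcal U}\to\mathcal U)$ together with natural transformations $$\widehat{\Sigma}:\sum_{A:\mathcal{U}}\mathcal{U}^{[A]}\to\mathcal{U},\qquad \widehat{\mathsf{pair}}:\sum_{A:\mathcal{U}}\ \sum_{B:\mathcal{U}^{[A]}}\ \sum_{a:[A]}[B(a)]\to\dot{\mathcal{U}}$$ such that the square with top $\widehat{\mathsf{pair}}$, right $p$, bottom $\widehat{\Sigma}$ and left the projection $\pi:(A,B,a,b)\mapsto(A,B)$ is a pullback in $\widehat{\mathbb{C}}$. (The correspondence is $\widehat{\Sigma}_\Gamma(A,B)=\mathsf{sigma}(A,B)$ and $\widehat{\mathsf{pair}}_\Gamma(A,B,a,b)=\mathsf{pair}_{A,B}(a,b)$.)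
   Context: Write $\mathsf{y}$ for the Yoneda embedding of a small category $\mathbb{C}$ into $\widehat{\mathbb{C}}=\mathbf{Set}^{\mathbb{C}^{\mathrm{op}}}$; elements $x\in P(\Gamma)$ are identified with maps $x:\mathsf{y}(\Gamma)\to P$, and $x[\sigma]=P(\sigma)(x)$. A natural model $(\mathbb{C},p)$ consists of a small category $\mathbb{C}$ with a distinguished terminal object $\diamond$, presheaves $\mathcal{U},\dot{\mathcal{U}}$ on $\mathbb{C}$, a natural transformation $p:\dot{\mathcal{U}}\to\mathcal{U}$ and, for each object $\Gamma$ and $A\in\mathcal{U}(\Gamma)$, a chosen object $\Gamma\cdot A$, morphism $\mathsf{p}_A:\Gamma\cdot A\to\Gamma$ and element $\mathsf{q}_A\in\dot{\mathcal{U}}(\Gamma\cdot A)$ such that the square with top $\mathsf{q}_A$, right $p$, left $\mathsf{y}(\mathsf{p}_A)$, bottom $A$ is a pullback. Write $\dot{\mathcal{U}}(\Gamma;A)=p_\Gamma^{-1}(A)$. For $\sigma:\Delta\to\Gamma$ and $a\in\dot{\mathcal{U}}(\Delta;A[\sigma])$, $\langle\sigma,a\rangle_A:\Delta\to\Gamma\cdot A$ is the unique map with $\mathsf{p}_A\circ\langle\sigma,a\rangle_A=\sigma$, $\mathsf{q}_A[\langle\sigma,a\rangle_A]=a$; $\mathsf{s}(a)=\langle\mathrm{id}_\Gamma,a\rangle_A$ for $a\in\dot{\mathcal U}(\Gamma;A)$; and $\sigma\cdot A=\langle\sigma\circ\mathsf{p}_{A[\sigma]},\mathsf{q}_{A[\sigma]}\rangle_A:\Delta\cdot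 A[\sigma]\to\Gamma\cdot A$. In the internal language of $\widehat{\mathbb{C}}$, $[A]$ denotes the fibre of $p$ over $A:\mathcal{U}$. Concretely (up to natural isomorphism) $\big(\sum_{A:\mathcal{U}}\mathcal{U}^{[A]}\big)(\Gamma)=\{(A,B): A\in\mathcal{U}(\Gamma),\,B\in\mathcal{U}(\Gamma\cdot A)\}$ with $(A,B)[\sigma]=(A[\sigma],B[\sigma\cdot A])$, and $\big(\sum_{A}\sum_{B}\sum_{a:[A]}[B(a)]\big)(\Gamma)=\{(A,B,a,b): A\in\mathcal{U}(\Gamma), B\in\mathcal{U}(\Gamma\cdot A), a\in\dot{\mathcal{U}}(\Gamma;A), b\in\dot{\mathcal{U}}(\Gamma;B[\mathsf{s}(a)])\}$ with the evident action. Natural models are exactly the models of an essentially algebraic theory $\mathbb{T}$ (sorts: contexts = objects of $\mathbb{C}$, substitutions = morphisms, types = elements of the $\mathcal{U}(\Gamma)$, terms = elements of the $\dot{\mathcal{U}}(\Gamma)$). The theory $\mathbb{T}_\Sigma$ extends $\mathbb{T}$ by partial operations, defined precisely for $\Gamma$, $A\in\mathcal{U}(\Gamma)$, $B\in\mathcal{U}(\Gamma\cdot A)$ and: $\mathsf{sigma}(A,B)$ (a type); $\mathsf{pair}_{A,B}(a,b)$ (a term) for $a\in\dot{\mathcal{U}}(\Gamma;A)$, $b\in\dot{\mathcal{U}}(\Gamma;B[\mathsf{s}(a)])$; $\mathsf{fst}_{A,B}(c)$ and $\mathsf{snd}_{A,B}(c)$ (terms) for terms $c$ of type $\mathsf{sigma}(A,B)$;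 subject to the equations - $\mathsf{sigma}(A,B)\in\mathcal{U}(\Gamma)$, $\mathsf{sigma}(A,B)[\sigma]=\mathsf{sigma}(A[\sigma],B[\sigma\cdot A])$; - $\mathsf{pair}_{A,B}(a,b)$ has type $\mathsf{sigma}(A,B)$, $\mathsf{pair}_{A,B}(a,b)[\sigma]=\mathsf{pair}_{A[\sigma],B[\sigma\cdot A]}(a[\sigma],b[\sigma])$; - $\mathsf{fst}_{A,B}(c)$ has type $A$, $\mathsf{fst}_{A,B}(c)[\sigma]=\mathsf{fst}_{A[\sigma],B[\sigma\cdot A]}(c[\sigma])$; - $\mathsf{snd}_{A,B}(c)$ has type $B[\mathsf{s}(\mathsf{fst}_{A,B}(c))]$, $\mathsf{snd}_{A,B}(c)[\sigma]=\mathsf{snd}_{A[\sigma],B[\sigma\cdot A]}(c[\sigma])$; - $\mathsf{fst}_{A,B}(\mathsf{pair}_{A,B}(a,b))=a$, $\mathsf{snd}_{A,B}(\mathsf{pair}_{A,B}(a,b))=b$, $\mathsf{pair}_{A,B}(\mathsf{fst}_{A,B}(c),\mathsf{snd}_{A,B}(c))=c$. *)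

theory Defs
  imports Main "HOL-Library.FuncSet"
begin

section \<open>Small categories\<close>

record ('o, 'm) cat =
  Ob :: "'o set"
  Ar :: "'m set"
  Dom :: "'m \<Rightarrow> 'o"
  Cod :: "'m \<Rightarrow> 'o"
  Ident :: "'o \<Rightarrow> 'm"
  Comp :: "'m \<Rightarrow> 'm \<Rightarrow> 'm"  \<comment> \<open>\<open>Comp C \<sigma> \<tau>\<close> is \<open>\<sigma> \<circ> \<tau>\<close>\<close>

definition hom :: "('o, 'm) cat \<Rightarrow> 'o \<Rightarrow> 'o \<Rightarrow> 'm set" where
  "hom C X Y = {f \<in> Ar C. Dom C f = X \<and> Cod C f = Y}"

definition category :: "('o, 'm) cat \<Rightarrow> bool" where
  "category C \<longleftrightarrow>
     (\<forall>f\<in>Ar C. Dom C f \<in> Ob C \<and> Cod C f \<in> Ob C) \<and>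
     (\<forall>X\<in>Ob C. Ident C X \<in> hom C X X) \<and>
     (\<forall>f\<in>Ar C. \<forall>g\<in>Ar C. Cod C f = Dom C g \<longrightarrow> Comp C g f \<in> hom C (Dom C f) (Cod C g)) \<and>
     (\<forall>f\<in>Ar C. Comp C f (Ident C (Dom C f)) = f \<and> Comp C (Ident C (Cod C f)) f = f) \<and>
     (\<forall>f\<in>Ar C. \<forall>g\<in>Ar C. \<forall>h\<in>Ar C. Cod C f = Dom C g \<longrightarrow> Cod C g = Dom C h \<longrightarrow>
        Comp C h (Comp C g f) = Comp C (Comp C h g) f)"

definition terminal :: "('o, 'm) cat \<Rightarrow> 'o \<Rightarrow> bool" where
  "terminal C X \<longleftrightarrow> X \<in> Ob C \<and> (\<forall>Y\<in>Ob C. \<exists>!f. f \<in> hom C Y X)"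


section \<open>Presheaves\<close>

record ('o, 'm, 'x) psh =
  El :: "'o \<Rightarrow> 'x set"
  Act :: "'m \<Rightarrow> 'x \<Rightarrow> 'x"  \<comment> \<open>\<open>Act P \<sigma> x\<close> is \<open>x[\<sigma>]\<close>\<close>

definition presheaf :: "('o, 'm) cat \<Rightarrow> ('o, 'm, 'x) psh \<Rightarrow> bool" where
  "presheaf C P \<longleftrightarrow>
     (\<forall>f\<in>Ar C. \<forall>x\<in>El P (Cod C f). Act P f x \<in> El P (Dom C f)) \<and>
     (\<forall>X\<in>Ob C. \<forall>x\<in>El P X. Act P (Ident C X) x = x) \<and>
     (\<forall>f\<in>Ar C. \<forall>g\<in>Ar C. Cod C f = Dom C g \<longrightarrow>
        (\<forall>x\<in>El P (Cod C g). Act P (Comp C g f) x = Act P f (Act P g x)))"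

text \<open>
  Components are \<^const>\<open>undefined\<close> off their domain (this is what the extensional
  function spaces enforce), so that equality of natural transformations is equality in HOL.
\<close>

definition nat_trans ::
  "('o, 'm) cat \<Rightarrow> ('o, 'm, 'x) psh \<Rightarrow> ('o, 'm, 'y) psh \<Rightarrow> ('o \<Rightarrow> 'x \<Rightarrow> 'y) \<Rightarrow> bool" where
  "nat_trans C P Q \<eta> \<longleftrightarrow>
     presheaf C P \<and> presheaf C Q \<and>
     \<eta> \<in> (\<Pi>\<^sub>E X\<in>Ob C. El P X \<rightarrow>\<^sub>E El Q X) \<and>
     (\<forall>f\<in>Ar C. \<forall>x\<in>El P (Cod C f). \<eta> (Dom C f) (Act P f x) = Act Q f (\<eta> (Cod C f) x))"

definition nt_comp ::
  "('o, 'm) cat \<Rightarrow> ('o, 'm, 'x) psh \<Rightarrow> ('o \<Rightarrow> 'y \<Rightarrow> 'z) \<Rightarrow> ('o \<Rightarrow> 'x \<Rightarrow> 'y) \<Rightarrow> ('o \<Rightarrow> 'x \<Rightarrow> 'z)" where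
  "nt_comp C P \<theta> \<eta> = (\<lambda>X\<in>Ob C. \<lambda>x\<in>El P X. \<theta> X (\<eta> X x))"

definition yo :: "('o, 'm) cat \<Rightarrow> 'o \<Rightarrow> ('o, 'm, 'm) psh" where
  "yo C X = \<lparr>El = (\<lambda>Y. hom C Y X), Act = (\<lambda>g f. Comp C f g)\<rparr>"

definition yo_arr :: "('o, 'm) cat \<Rightarrow> 'm \<Rightarrow> ('o \<Rightarrow> 'm \<Rightarrow> 'm)" where
  "yo_arr C f = (\<lambda>Y\<in>Ob C. \<lambda>g\<in>hom C Y (Dom C f). Comp C f g)"

text \<open>The map \<open>y(X) \<rightarrow> P\<close> that corresponds to \<open>x \<in> P(X)\<close>.\<close>

definition yo_el :: "('o, 'm) cat \<Rightarrow> ('o, 'm, 'x) psh \<Rightarrow> 'o \<Rightarrow> 'x \<Rightarrow> ('o \<Rightarrow> 'm \<Rightarrow> 'x)" where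
  "yo_el C P X x = (\<lambda>Y\<in>Ob C. \<lambda>f\<in>hom C Y X. Act P f x)"

text \<open>
  The square
    \<open>P \<midarrow>t\<rightarrow> Q\<close>, \<open>P \<midarrow>l\<rightarrow> R\<close>, \<open>Q \<midarrow>r\<rightarrow> S\<close>, \<open>R \<midarrow>b\<rightarrow> S\<close>
  is a pullback in the category of presheaves.  A HOL formula cannot quantify over types, so the
  test objects \<open>T\<close> are the presheaves whose values are subsets of \<open>'m + 'u\<close>, with \<open>'u\<close> arbitrary.
  The summand \<open>'m\<close> provides a copy of every representable presheaf, so that no choice of \<open>'u\<close>
  gives a notion weaker than the pointwise one, and the notion is the same for all \<open>'u\<close>.
\<close>

definition is_pullback ::
  "'u itself \<Rightarrow> ('o, 'm) cat \<Rightarrow>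
   ('o, 'm, 'p) psh \<Rightarrow> ('o, 'm, 'q) psh \<Rightarrow> ('o, 'm, 'r) psh \<Rightarrow> ('o, 'm, 's) psh \<Rightarrow>
   ('o \<Rightarrow> 'p \<Rightarrow> 'q) \<Rightarrow> ('o \<Rightarrow> 'p \<Rightarrow> 'r) \<Rightarrow> ('o \<Rightarrow> 'q \<Rightarrow> 's) \<Rightarrow> ('o \<Rightarrow> 'r \<Rightarrow> 's) \<Rightarrow> bool" where
  "is_pullback (U :: 'u itself) C P Q R S t l r b \<longleftrightarrow>
     nat_trans C P Q t \<and> nat_trans C P R l \<and> nat_trans C Q S r \<and> nat_trans C R S b \<and>
     nt_comp C P r t = nt_comp C P b l \<and>
     (\<forall>(T :: ('o, 'm, 'm + 'u) psh) h k.
        nat_trans C T Q h \<and> nat_trans C T R k \<and> nt_comp C T r h = nt_comp C T b k \<longrightarrow>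
        (\<exists>!u. nat_trans C T P u \<and> nt_comp C T t u = h \<and> nt_comp C T l u = k))"


section \<open>Natural models\<close>

record ('o, 'm, 'ty, 'tm) nmodel =
  ctx :: "('o, 'm) cat"
  emp :: 'o
  Ty :: "('o, 'm, 'ty) psh"
  Tm :: "('o, 'm, 'tm) psh"
  typ_of :: "'o \<Rightarrow> 'tm \<Rightarrow> 'ty"
  cext :: "'o \<Rightarrow> 'ty \<Rightarrow> 'o"
  proj :: "'o \<Rightarrow> 'ty \<Rightarrow> 'm"
  var :: "'o \<Rightarrow> 'ty \<Rightarrow> 'tm"

definition natural_model :: "'u itself \<Rightarrow> ('o, 'm, 'ty, 'tm) nmodel \<Rightarrow> bool" where
  "natural_model U N \<longleftrightarrow>
     category (ctx N) \<and> terminal (ctx N) (emp N) \<and>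
     nat_trans (ctx N) (Tm N) (Ty N) (typ_of N) \<and>
     (\<forall>G\<in>Ob (ctx N). \<forall>A\<in>El (Ty N) G.
        cext N G A \<in> Ob (ctx N) \<and>
        proj N G A \<in> hom (ctx N) (cext N G A) G \<and>
        var N G A \<in> El (Tm N) (cext N G A) \<and>
        is_pullback U (ctx N) (yo (ctx N) (cext N G A)) (Tm N) (yo (ctx N) G) (Ty N)
          (yo_el (ctx N) (Tm N) (cext N G A) (var N G A))
          (yo_arr (ctx N) (proj N G A))
          (typ_of N)
          (yo_el (ctx N) (Ty N) G A))"

definition tms :: "('o, 'm, 'ty, 'tm) nmodel \<Rightarrow> 'o \<Rightarrow> 'ty \<Rightarrow> 'tm set" where
  "tms N G A = {a \<in> El (Tm N) G. typ_of N G a = A}"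

text \<open>\<open>pairing N A \<sigma> a\<close> is \<open>\<langle>\<sigma>, a\<rangle>\<^sub>A\<close>, where \<open>A\<close> is a type over the codomain of \<open>\<sigma>\<close>.\<close>

definition pairing :: "('o, 'm, 'ty, 'tm) nmodel \<Rightarrow> 'ty \<Rightarrow> 'm \<Rightarrow> 'tm \<Rightarrow> 'm" where
  "pairing N A \<sigma> a =
     (let G = Cod (ctx N) \<sigma> in
      THE \<tau>. \<tau> \<in> hom (ctx N) (Dom (ctx N) \<sigma>) (cext N G A) \<and>
        Comp (ctx N) (proj N G A) \<tau> = \<sigma> \<and> Act (Tm N) \<tau> (var N G A) = a)"

definition sect :: "('o, 'm, 'ty, 'tm) nmodel \<Rightarrow> 'o \<Rightarrow> 'tm \<Rightarrow> 'm" where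
  "sect N G a = pairing N (typ_of N G a) (Ident (ctx N) G) a"

text \<open>\<open>weaken N \<sigma> A\<close> is \<open>\<sigma> \<cdot> A : \<Delta> \<cdot> A[\<sigma>] \<rightarrow> \<Gamma> \<cdot> A\<close>, for \<open>\<sigma> : \<Delta> \<rightarrow> \<Gamma>\<close> and a type \<open>A\<close> over \<open>\<Gamma>\<close>.\<close>

definition weaken :: "('o, 'm, 'ty, 'tm) nmodel \<Rightarrow> 'm \<Rightarrow> 'ty \<Rightarrow> 'm" where
  "weaken N \<sigma> A =
     (let D = Dom (ctx N) \<sigma>; A' = Act (Ty N) \<sigma> A in
      pairing N A (Comp (ctx N) \<sigma> (proj N D A')) (var N D A'))"


section \<open>The presheaves that classify the premises of formation and introduction\<close>

text \<open>\<open>\<Sum>\<^bsub>A:U\<^esub> U\<^bsup>[A]\<^esup>\<close>\<close>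

definition form_psh :: "('o, 'm, 'ty, 'tm) nmodel \<Rightarrow> ('o, 'm, 'ty \<times> 'ty) psh" where
  "form_psh N =
     \<lparr>El = (\<lambda>G. {(A, B). A \<in> El (Ty N) G \<and> B \<in> El (Ty N) (cext N G A)}),
      Act = (\<lambda>\<sigma> (A, B). (Act (Ty N) \<sigma> A, Act (Ty N) (weaken N \<sigma> A) B))\<rparr>"

text \<open>\<open>\<Sum>\<^bsub>A:U\<^esub> \<Sum>\<^bsub>B:U\<^bsup>[A]\<^esup>\<^esub> \<Sum>\<^bsub>a:[A]\<^esub> [B(a)]\<close>\<close>

definition intro_psh :: "('o, 'm, 'ty, 'tm) nmodel \<Rightarrow> ('o, 'm, 'ty \<times> 'ty \<times> 'tm \<times> 'tm) psh" where
  "intro_psh N =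
     \<lparr>El = (\<lambda>G. {(A, B, a, b). A \<in> El (Ty N) G \<and> B \<in> El (Ty N) (cext N G A) \<and>
                    a \<in> tms N G A \<and> b \<in> tms N G (Act (Ty N) (sect N G a) B)}),
      Act = (\<lambda>\<sigma> (A, B, a, b). (Act (Ty N) \<sigma> A, Act (Ty N) (weaken N \<sigma> A) B,
                    Act (Tm N) \<sigma> a, Act (Tm N) \<sigma> b))\<rparr>"

definition intro_proj ::
  "('o, 'm, 'ty, 'tm) nmodel \<Rightarrow> ('o \<Rightarrow> 'ty \<times> 'ty \<times> 'tm \<times> 'tm \<Rightarrow> 'ty \<times> 'ty)" where
  "intro_proj N = (\<lambda>G\<in>Ob (ctx N). \<lambda>(A, B, a, b)\<in>El (intro_psh N) G. (A, B))"


section \<open>Models of the theory with dependent sums\<close>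

record ('o, 'ty, 'tm) sigma_ops =
  sg :: "'o \<Rightarrow> 'ty \<Rightarrow> 'ty \<Rightarrow> 'ty"
  pr :: "'o \<Rightarrow> 'ty \<Rightarrow> 'ty \<Rightarrow> 'tm \<Rightarrow> 'tm \<Rightarrow> 'tm"
  first :: "'o \<Rightarrow> 'ty \<Rightarrow> 'ty \<Rightarrow> 'tm \<Rightarrow> 'tm"
  second :: "'o \<Rightarrow> 'ty \<Rightarrow> 'ty \<Rightarrow> 'tm \<Rightarrow> 'tm"

text \<open>
  The dependent extensional function spaces state both that the partial operations are defined
  precisely on the arguments of the theory (they are \<^const>\<open>undefined\<close> elsewhere) and the typing
  equations.
\<close>

definition sigma_model ::
  "'u itself \<Rightarrow> ('o, 'm, 'ty, 'tm) nmodel \<Rightarrow> ('o, 'ty, 'tm) sigma_ops \<Rightarrow> bool" where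
  "sigma_model U N S \<longleftrightarrow>
     natural_model U N \<and>
     sg S \<in> (\<Pi>\<^sub>E G\<in>Ob (ctx N). \<Pi>\<^sub>E A\<in>El (Ty N) G. \<Pi>\<^sub>E B\<in>El (Ty N) (cext N G A). El (Ty N) G) \<and>
     pr S \<in> (\<Pi>\<^sub>E G\<in>Ob (ctx N). \<Pi>\<^sub>E A\<in>El (Ty N) G. \<Pi>\<^sub>E B\<in>El (Ty N) (cext N G A).
       \<Pi>\<^sub>E a\<in>tms N G A. \<Pi>\<^sub>E b\<in>tms N G (Act (Ty N) (sect N G a) B). tms N G (sg S G A B)) \<and>
     first S \<in> (\<Pi>\<^sub>E G\<in>Ob (ctx N). \<Pi>\<^sub>E A\<in>El (Ty N) G. \<Pi>\<^sub>E B\<in>El (Ty N) (cext N G A).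
       \<Pi>\<^sub>E c\<in>tms N G (sg S G A B). tms N G A) \<and>
     second S \<in> (\<Pi>\<^sub>E G\<in>Ob (ctx N). \<Pi>\<^sub>E A\<in>El (Ty N) G. \<Pi>\<^sub>E B\<in>El (Ty N) (cext N G A).
       \<Pi>\<^sub>E c\<in>tms N G (sg S G A B). tms N G (Act (Ty N) (sect N G (first S G A B c)) B)) \<and>
     (\<forall>D\<in>Ob (ctx N). \<forall>G\<in>Ob (ctx N). \<forall>\<sigma>\<in>hom (ctx N) D G.
      \<forall>A\<in>El (Ty N) G. \<forall>B\<in>El (Ty N) (cext N G A).
        let A' = Act (Ty N) \<sigma> A; B' = Act (Ty N) (weaken N \<sigma> A) B in
        Act (Ty N) \<sigma> (sg S G A B) = sg S D A' B' \<and>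
        (\<forall>a\<in>tms N G A. \<forall>b\<in>tms N G (Act (Ty N) (sect N G a) B).
           Act (Tm N) \<sigma> (pr S G A B a b) = pr S D A' B' (Act (Tm N) \<sigma> a) (Act (Tm N) \<sigma> b)) \<and>
        (\<forall>c\<in>tms N G (sg S G A B).
           Act (Tm N) \<sigma> (first S G A B c) = first S D A' B' (Act (Tm N) \<sigma> c) \<and>
           Act (Tm N) \<sigma> (second S G A B c) = second S D A' B' (Act (Tm N) \<sigma> c))) \<and>
     (\<forall>G\<in>Ob (ctx N). \<forall>A\<in>El (Ty N) G. \<forall>B\<in>El (Ty N) (cext N G A).
        (\<forall>a\<in>tms N G A. \<forall>b\<in>tms N G (Act (Ty N) (sect N G a) B).
           first S G A B (pr S G A B a b) = a \<and> second S G A B (pr S G A B a b) = b) \<and>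
        (\<forall>c\<in>tms N G (sg S G A B). pr S G A B (first S G A B c) (second S G A B c) = c))"

definition sigma_square ::
  "'u itself \<Rightarrow> ('o, 'm, 'ty, 'tm) nmodel \<Rightarrow> ('o \<Rightarrow> 'ty \<times> 'ty \<Rightarrow> 'ty) \<Rightarrow>
   ('o \<Rightarrow> 'ty \<times> 'ty \<times> 'tm \<times> 'tm \<Rightarrow> 'tm) \<Rightarrow> bool" where
  "sigma_square U N s q \<longleftrightarrow>
     natural_model U N \<and>
     nat_trans (ctx N) (form_psh N) (Ty N) s \<and>
     nat_trans (ctx N) (intro_psh N) (Tm N) q \<and>
     is_pullback U (ctx N) (intro_psh N) (Tm N) (form_psh N) (Ty N) q (intro_proj N) (typ_of N) s"

definition sigma_hat ::
  "('o, 'm, 'ty, 'tm) nmodel \<Rightarrow> ('o, 'ty, 'tm) sigma_ops \<Rightarrow> ('o \<Rightarrow> 'ty \<times> 'ty \<Rightarrow> 'ty)" where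
  "sigma_hat N S = (\<lambda>G\<in>Ob (ctx N). \<lambda>(A, B)\<in>El (form_psh N) G. sg S G A B)"

definition pair_hat ::
  "('o, 'm, 'ty, 'tm) nmodel \<Rightarrow> ('o, 'ty, 'tm) sigma_ops \<Rightarrow>
   ('o \<Rightarrow> 'ty \<times> 'ty \<times> 'tm \<times> 'tm \<Rightarrow> 'tm)" where
  "pair_hat N S = (\<lambda>G\<in>Ob (ctx N). \<lambda>(A, B, a, b)\<in>El (intro_psh N) G. pr S G A B a b)"

end

theory Submission
  imports Defs
begin

text \<open>
  A square of presheaves is a pullback iff it is one pointwise: the test presheaves contain a copy
  of every representable, and by the Yoneda lemma a cone from a representable is a matching pair of
  elements.  For the square of the theorem, pointwise means that for each \<open>(A, B)\<close> the operation
  \<open>pair\<close> is a bijection from the pairs \<open>(a, b)\<close> to the terms of type \<open>sigma A B\<close>; \<open>fst\<close> and \<open>snd\<close>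
  are the components of its inverse, hence uniquely determined, and they are stable under
  substitution because \<open>pair\<close> is.
\<close>

text \<open>The pointwise criterion is used twice. Applied to the squares that define context
  extension, it gives the universal property of \<open>cext N G A\<close> as a statement about
  substitutions, from which all laws of \<open>pairing\<close>, \<open>sect\<close> and
  \<open>weaken\<close> follow. Applied to the square of the theorem, it gives the bijection between
  pairs and terms. The substitution laws are needed because \<open>B\<close> lives over the extended
  context: \<open>form_psh\<close> and \<open>intro_psh\<close> are presheaves only if weakening is
  strictly functorial, and \<open>b[f]\<close> has the type that \<open>intro_psh\<close> demands
  only if weakening is compatible with the sections of \<open>a\<close> and \<open>a[f]\<close>. The
  other constraint is that the theorem compares structures by HOL equality. Operations and
  transformations are \<open>undefined\<close> off their domains, so values on the domain decide;
  but the domains and codomains depend on other operations (\<open>pr\<close>, \<open>first\<close>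
  and \<open>second\<close> on \<open>sg\<close>, and \<open>second\<close> also on
  \<open>first\<close>), and this dictates the order in which two models are identified.\<close>

lemma ex1_unique:
  assumes "\<exists>!x. P x" "P a" "P b"
  shows "a = b"
  using assms by blast

text \<open>The three layers are the arguments \<open>G\<close>, \<open>A\<close>, \<open>B\<close>
  shared by all four operations; the further arguments of \<open>pr\<close>, \<open>first\<close>
  and \<open>second\<close> are peeled off one at a time.\<close>

lemma PiE3_mem:
  assumes "f \<in> (\<Pi>\<^sub>E x\<in>A. \<Pi>\<^sub>E y\<in>B x. \<Pi>\<^sub>E z\<in>C x y. D x y z)" "x \<in> A" "y \<in> B x" "z \<in> C x y"
  shows "f x y z \<in> D x y z"
  using PiE_mem[OF PiE_mem[OF PiE_mem[OF assms(1,2)] assms(3)] assms(4)] .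

lemma PiE3_eqI:
  assumes f: "f \<in> (\<Pi>\<^sub>E x\<in>A. \<Pi>\<^sub>E y\<in>B x. \<Pi>\<^sub>E z\<in>C x y. D x y z)"
    and g: "g \<in> (\<Pi>\<^sub>E x\<in>A. \<Pi>\<^sub>E y\<in>B x. \<Pi>\<^sub>E z\<in>C x y. D x y z)"
    and eq: "\<And>x y z. x \<in> A \<Longrightarrow> y \<in> B x \<Longrightarrow> z \<in> C x y \<Longrightarrow> f x y z = g x y z"
  shows "f = g"
proof (rule PiE_ext[OF f g])
  fix x assume x: "x \<in> A"
  note fx = PiE_mem[OF f x] PiE_mem[OF g x]
  show "f x = g x"
  proof (rule PiE_ext[OF fx])
    fix y assume y: "y \<in> B x"
    show "f x y = g x y" by (rule PiE_ext[OF PiE_mem[OF fx(1) y] PiE_mem[OF fx(2) y] eq[OF x y]])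
  qed
qed

section \<open>Categories and presheaves\<close>

lemma homD:
  assumes "f \<in> hom C X Y"
  shows "f \<in> Ar C" "Dom C f = X" "Cod C f = Y"
  using assms by (auto simp: hom_def)

lemma category_hom_ob:
  assumes "category C" "f \<in> hom C X Y"
  shows "X \<in> Ob C" "Y \<in> Ob C"
  using assms by (auto simp: hom_def category_def)

lemma category_ident:
  assumes "category C" "X \<in> Ob C"
  shows "Ident C X \<in> hom C X X"
  using assms by (auto simp: category_def)

lemma category_comp:
  assumes "category C" "f \<in> hom C X Y" "g \<in> hom C Y Z"
  shows "Comp C g f \<in> hom C X Z"
  using assms unfolding category_def hom_def by fastforce

lemma category_ident_right:
  assumes "category C" "f \<in> hom C X Y"
  shows "Comp C f (Ident C X) = f"
  using assms by (auto simp: category_def hom_def)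

lemma category_ident_left:
  assumes "category C" "f \<in> hom C X Y"
  shows "Comp C (Ident C Y) f = f"
  using assms by (auto simp: category_def hom_def)

lemma category_assoc:
  assumes "category C" "f \<in> hom C X Y" "g \<in> hom C Y Z" "h \<in> hom C Z W"
  shows "Comp C h (Comp C g f) = Comp C (Comp C h g) f"
  using assms by (auto simp: category_def hom_def)

lemma presheaf_act:
  assumes "presheaf C P" "f \<in> hom C X Y" "x \<in> El P Y"
  shows "Act P f x \<in> El P X"
  using assms by (auto simp: presheaf_def hom_def)

lemma presheaf_ident:
  assumes "presheaf C P" "X \<in> Ob C" "x \<in> El P X"
  shows "Act P (Ident C X) x = x"
  using assms by (auto simp: presheaf_def)

lemma presheaf_comp:
  assumes "presheaf C P" "f \<in> hom C X Y" "g \<in> hom C Y Z" "x \<in> El P Z"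
  shows "Act P (Comp C g f) x = Act P f (Act P g x)"
  using assms by (auto simp: presheaf_def hom_def)

lemma presheafI:
  assumes "category C"
    and "\<And>X Y f x. f \<in> hom C X Y \<Longrightarrow> x \<in> El P Y \<Longrightarrow> Act P f x \<in> El P X"
    and "\<And>X x. X \<in> Ob C \<Longrightarrow> x \<in> El P X \<Longrightarrow> Act P (Ident C X) x = x"
    and "\<And>X Y Z f g x. f \<in> hom C X Y \<Longrightarrow> g \<in> hom C Y Z \<Longrightarrow> x \<in> El P Z \<Longrightarrow>
      Act P (Comp C g f) x = Act P f (Act P g x)"
  shows "presheaf C P"
  unfolding presheaf_def using assms(2-4) by (auto simp: hom_def)

lemma nat_trans_psh:
  assumes "nat_trans C P Q \<eta>"
  shows "presheaf C P" "presheaf C Q"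
  using assms by (auto simp: nat_trans_def)

lemma nat_trans_mem:
  assumes "nat_trans C P Q \<eta>" "X \<in> Ob C" "x \<in> El P X"
  shows "\<eta> X x \<in> El Q X"
  using assms by (auto simp: nat_trans_def PiE_iff)

lemma nat_trans_nat:
  assumes "nat_trans C P Q \<eta>" "f \<in> hom C X Y" "x \<in> El P Y"
  shows "\<eta> X (Act P f x) = Act Q f (\<eta> Y x)"
  using assms by (auto simp: nat_trans_def hom_def)

lemma nat_transI:
  assumes "presheaf C P" "presheaf C Q"
    and "\<And>X x. X \<in> Ob C \<Longrightarrow> x \<in> El P X \<Longrightarrow> \<eta> X x \<in> El Q X"
    and "\<And>X x. X \<in> Ob C \<Longrightarrow> x \<notin> El P X \<Longrightarrow> \<eta> X x = undefined"
    and "\<And>X. X \<notin> Ob C \<Longrightarrow> \<eta> X = undefined"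
    and "\<And>X Y f x. f \<in> hom C X Y \<Longrightarrow> x \<in> El P Y \<Longrightarrow> \<eta> X (Act P f x) = Act Q f (\<eta> Y x)"
  shows "nat_trans C P Q \<eta>"
  unfolding nat_trans_def using assms by (auto simp: PiE_iff extensional_def hom_def)

lemma nat_trans_eqI:
  assumes "nat_trans C P Q \<eta>" "nat_trans C P Q \<theta>"
    and "\<And>X x. X \<in> Ob C \<Longrightarrow> x \<in> El P X \<Longrightarrow> \<eta> X x = \<theta> X x"
  shows "\<eta> = \<theta>"
proof (intro ext)
  fix X x
  show "\<eta> X x = \<theta> X x"
    using assms unfolding nat_trans_def PiE_iff extensional_def
    by (cases "X \<in> Ob C"; cases "x \<in> El P X") auto
qed

lemma nt_comp_apply:
  assumes "X \<in> Ob C" "x \<in> El P X"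
  shows "nt_comp C P \<theta> \<eta> X x = \<theta> X (\<eta> X x)"
  using assms by (simp add: nt_comp_def)

lemma nt_comp_eq_iff:
  "nt_comp C P \<theta> \<eta> = nt_comp C P \<theta>' \<eta>' \<longleftrightarrow>
    (\<forall>X\<in>Ob C. \<forall>x\<in>El P X. \<theta> X (\<eta> X x) = \<theta>' X (\<eta>' X x))"
  by (auto simp: nt_comp_apply nt_comp_def fun_eq_iff restrict_def)

lemma nt_comp_eqI:
  assumes "nat_trans C P R \<zeta>"
    and "\<And>X x. X \<in> Ob C \<Longrightarrow> x \<in> El P X \<Longrightarrow> \<theta> X (\<eta> X x) = \<zeta> X x"
  shows "nt_comp C P \<theta> \<eta> = \<zeta>"
proof (intro ext)
  fix X x
  show "nt_comp C P \<theta> \<eta> X x = \<zeta> X x"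
    using assms unfolding nat_trans_def PiE_iff extensional_def nt_comp_def restrict_def
    by (cases "X \<in> Ob C"; cases "x \<in> El P X") auto
qed

text \<open>The representable presheaf, with values in the type over which \<^const>\<open>is_pullback\<close> tests.\<close>

definition yo_inl :: "('o, 'm) cat \<Rightarrow> 'o \<Rightarrow> ('o, 'm, 'm + 'u) psh" where
  "yo_inl C X = \<lparr>El = (\<lambda>Y. Inl ` hom C Y X), Act = (\<lambda>g w. Inl (Comp C (projl w) g))\<rparr>"

definition yo_inl_el ::
  "('o, 'm) cat \<Rightarrow> ('o, 'm, 'x) psh \<Rightarrow> 'o \<Rightarrow> 'x \<Rightarrow> ('o \<Rightarrow> 'm + 'u \<Rightarrow> 'x)" where
  "yo_inl_el C P X x = (\<lambda>Y\<in>Ob C. \<lambda>w\<in>Inl ` hom C Y X. Act P (projl w) x)"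

section \<open>The Yoneda lemma for the tagged representables\<close>

lemma presheaf_yo_inl:
  assumes "category C"
  shows "presheaf C (yo_inl C X)"
proof (rule presheafI[OF assms])
  fix Y Z W f g and x :: "'b + 'c"
  assume "f \<in> hom C Y Z" "g \<in> hom C Z W" "x \<in> El (yo_inl C X) W"
  then show "Act (yo_inl C X) (Comp C g f) x = Act (yo_inl C X) f (Act (yo_inl C X) g x)"
    by (auto simp: yo_inl_def intro: category_assoc[OF assms])
qed (auto simp: yo_inl_def category_ident_right[OF assms] intro: category_comp[OF assms])

lemma nat_trans_yo_inl_el:
  assumes "category C" "presheaf C P" "x \<in> El P X"
  shows "nat_trans C (yo_inl C X) P (yo_inl_el C P X x)"
proof (rule nat_transI[OF presheaf_yo_inl[OF assms(1)] assms(2)])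
  fix Y Z f and w :: "'b + 'd"
  assume f: "f \<in> hom C Y Z" and w: "w \<in> El (yo_inl C X) Z"
  then obtain g where g: "w = Inl g" "g \<in> hom C Z X" by (auto simp: yo_inl_def)
  have "Comp C g f \<in> hom C Y X" using category_comp[OF assms(1) f g(2)] .
  then show "yo_inl_el C P X x Y (Act (yo_inl C X) f w) = Act P f (yo_inl_el C P X x Z w)"
    using f g assms category_hom_ob[OF assms(1) f]
    by (simp add: yo_inl_el_def yo_inl_def presheaf_comp)
qed (use assms in \<open>auto simp: yo_inl_el_def yo_inl_def intro: presheaf_act\<close>)

text \<open>Evaluation at the identity undoes \<open>yo_inl_el\<close>. This half of the Yoneda
  correspondence turns uniqueness of natural transformations into uniqueness of elements.\<close>

lemma yo_inl_el_ident:
  assumes "category C" "presheaf C P" "X \<in> Ob C" "x \<in> El P X"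
  shows "yo_inl_el C P X x X (Inl (Ident C X)) = x"
  using assms by (simp add: yo_inl_el_def category_ident presheaf_ident)

text \<open>Naturality of the Yoneda correspondence in the presheaf. With it, a matching pair of
  elements becomes a commuting cone.\<close>

lemma nt_comp_yo_inl_el:
  assumes "category C" "nat_trans C P Q \<eta>" "x \<in> El P X"
  shows "nt_comp C (yo_inl C X) \<eta> (yo_inl_el C P X x) = yo_inl_el C Q X (\<eta> X x)"
proof (intro ext)
  fix Y w
  show "nt_comp C (yo_inl C X) \<eta> (yo_inl_el C P X x) Y w = yo_inl_el C Q X (\<eta> X x) Y w"
    using assms nat_trans_nat[OF assms(2)]
    by (cases w) (auto simp: nt_comp_def yo_inl_el_def yo_inl_def restrict_def image_iff)
qed

section \<open>Pullbacks of presheaves and their pointwise form\<close>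

lemma is_pullback_pointwise_ex1:
  fixes U :: "'u itself"
  assumes C: "category C" and pb: "is_pullback U C P Q R S t l r b"
    and X: "X \<in> Ob C" and y: "y \<in> El Q X" and z: "z \<in> El R X" and eq: "r X y = b X z"
  shows "\<exists>!x. x \<in> El P X \<and> t X x = y \<and> l X x = z"
proof -
  have nt: "nat_trans C P Q t" "nat_trans C P R l" "nat_trans C Q S r" "nat_trans C R S b"
    using pb by (auto simp: is_pullback_def)
  note psh = nat_trans_psh[OF nt(1)] nat_trans_psh[OF nt(2)]
  let ?T = "yo_inl C X :: ('a, 'b, 'b + 'u) psh"
  have test: "nat_trans C ?T Q (yo_inl_el C Q X y)" "nat_trans C ?T R (yo_inl_el C R X z)"
    "nt_comp C ?T r (yo_inl_el C Q X y) = nt_comp C ?T b (yo_inl_el C R X z)"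
    using C psh y z nt eq by (simp_all add: nat_trans_yo_inl_el nt_comp_yo_inl_el)
  have ex1: "\<exists>!u. nat_trans C ?T P u \<and> nt_comp C ?T t u = yo_inl_el C Q X y \<and>
      nt_comp C ?T l u = yo_inl_el C R X z"
    using pb test unfolding is_pullback_def by blast
  then obtain u where u: "nat_trans C ?T P u" "nt_comp C ?T t u = yo_inl_el C Q X y"
      "nt_comp C ?T l u = yo_inl_el C R X z"
    by blast
  have id: "Inl (Ident C X) \<in> El ?T X" using C X by (simp add: yo_inl_def category_ident)
  show ?thesis
  \<comment> \<open>The witness is the element of \<open>P\<close> that corresponds to the mediating
    map \<open>u\<close>; the two triangle equations for \<open>u\<close>, read at the identity,
    give its images.\<close>
  proof (rule ex1I[of _ "u X (Inl (Ident C X))"])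
    show "u X (Inl (Ident C X)) \<in> El P X \<and> t X (u X (Inl (Ident C X))) = y \<and>
        l X (u X (Inl (Ident C X))) = z"
      using nat_trans_mem[OF u(1) X id] nt_comp_apply[where \<eta>=u and P="?T", OF X id]
        u(2,3) yo_inl_el_ident[OF C _ X] psh y z by metis
  next
    \<comment> \<open>Any solution \<open>x\<close> yields a mediating map
      \<open>yo_inl_el C P X x\<close>; uniqueness identifies it with \<open>u\<close>, and
      evaluation at the identity recovers \<open>x\<close>.\<close>
    fix x assume x: "x \<in> El P X \<and> t X x = y \<and> l X x = z"
    then have "nat_trans C ?T P (yo_inl_el C P X x)"
      "nt_comp C ?T t (yo_inl_el C P X x) = yo_inl_el C Q X y"
      "nt_comp C ?T l (yo_inl_el C P X x) = yo_inl_el C R X z"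
      using C psh nt by (simp_all add: nat_trans_yo_inl_el nt_comp_yo_inl_el)
    then have "yo_inl_el C P X x = u" using ex1 u by blast
    then show "x = u X (Inl (Ident C X))" using yo_inl_el_ident[OF C psh(1) X] x by metis
  qed
qed

text \<open>For each element \<open>w\<close> of a test presheaf, \<open>ex1\<close> singles out one
  element of \<open>P\<close> over the images of \<open>w\<close>. These choices form the mediating
  map, and the same uniqueness gives both its naturality and its uniqueness.\<close>

lemma is_pullbackI:
  fixes U :: "'u itself"
  assumes C: "category C" and t: "nat_trans C P Q t" and l: "nat_trans C P R l"
    and r: "nat_trans C Q S r" and b: "nat_trans C R S b"
    and comm: "\<And>X x. X \<in> Ob C \<Longrightarrow> x \<in> El P X \<Longrightarrow> r X (t X x) = b X (l X x)"
    and ex1: "\<And>X y z. X \<in> Ob C \<Longrightarrow> y \<in> El Q X \<Longrightarrow> z \<in> El R X \<Longrightarrow> r X y = b X z \<Longrightarrow>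
      \<exists>!x. x \<in> El P X \<and> t X x = y \<and> l X x = z"
  shows "is_pullback U C P Q R S t l r b"
proof -
  have "\<exists>!u. nat_trans C T P u \<and> nt_comp C T t u = h \<and> nt_comp C T l u = k"
    if h: "nat_trans C T Q h" and k: "nat_trans C T R k"
      and hk: "nt_comp C T r h = nt_comp C T b k"
    for T :: "('a, 'b, 'b + 'u) psh" and h k
  proof -
    have ex1': "\<exists>!x. x \<in> El P X \<and> t X x = h X w \<and> l X x = k X w"
      if "X \<in> Ob C" "w \<in> El T X" for X w
      using that hk ex1 nat_trans_mem[OF h] nat_trans_mem[OF k] by (simp add: nt_comp_eq_iff)
    define u where
      "u = (\<lambda>X\<in>Ob C. \<lambda>w\<in>El T X. THE x. x \<in> El P X \<and> t X x = h X w \<and> l X x = k X w)"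
    have u: "u X w \<in> El P X" "t X (u X w) = h X w" "l X (u X w) = k X w"
      if "X \<in> Ob C" "w \<in> El T X" for X w
      using theI'[OF ex1'[OF that]] that by (simp_all add: u_def)
    have nt: "nat_trans C T P u"
    proof (rule nat_transI[OF nat_trans_psh(1)[OF h] nat_trans_psh(1)[OF t]])
      fix X Y f w assume f: "f \<in> hom C X Y" and w: "w \<in> El T Y"
      note ob = category_hom_ob[OF C f]
      have fw: "Act T f w \<in> El T X" using presheaf_act[OF nat_trans_psh(1)[OF h] f w] .
      \<comment> \<open>\<open>Act P f (u Y w)\<close> lies over the images of
        \<open>Act T f w\<close>, because \<open>t\<close>, \<open>l\<close>, \<open>h\<close> and
        \<open>k\<close> are natural; so it is the element chosen there.\<close>
      have "Act P f (u Y w) \<in> El P X"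
        using presheaf_act[OF nat_trans_psh(1)[OF t] f] u(1) ob w by blast
      moreover have "t X (Act P f (u Y w)) = h X (Act T f w)"
        "l X (Act P f (u Y w)) = k X (Act T f w)"
        using nat_trans_nat[OF t f] nat_trans_nat[OF l f] nat_trans_nat[OF h f w]
          nat_trans_nat[OF k f w] u ob w by auto
      ultimately show "u X (Act T f w) = Act P f (u Y w)"
        using ex1'[OF ob(1) fw] u[OF ob(1) fw] by blast
    qed (auto simp: u(1), auto simp: u_def)
    show ?thesis
    proof (rule ex1I[of _ u], intro conjI)
      show "nat_trans C T P u" by (fact nt)
      show "nt_comp C T t u = h" by (rule nt_comp_eqI[OF h]) (rule u(2))
      show "nt_comp C T l u = k" by (rule nt_comp_eqI[OF k]) (rule u(3))
    next
      fix v assume v: "nat_trans C T P v \<and> nt_comp C T t v = h \<and> nt_comp C T l v = k"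
      show "v = u"
      proof (rule nat_trans_eqI[OF _ nt])
        show "nat_trans C T P v" using v by blast
        fix X w assume X: "X \<in> Ob C" and w: "w \<in> El T X"
        have "v X w \<in> El P X" "t X (v X w) = h X w" "l X (v X w) = k X w"
          using v nat_trans_mem[OF _ X w] nt_comp_apply[where P=T, OF X w] by metis+
        then show "v X w = u X w" using ex1'[OF X w] u[OF X w] by blast
      qed
    qed
  qed
  then show ?thesis
    unfolding is_pullback_def using t l r b comm by (auto simp: nt_comp_eq_iff)
qed

section \<open>Substitution in natural models\<close>

locale nat_model =
  fixes U :: "'u itself" and N :: "('o, 'm, 'ty, 'tm) nmodel"
  assumes natural_model: "natural_model U N"
begin

abbreviation C where "C \<equiv> ctx N"

lemma category: "category C"
  using natural_model by (simp add: natural_model_def)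

lemma typ_of_nat_trans: "nat_trans C (Tm N) (Ty N) (typ_of N)"
  using natural_model by (simp add: natural_model_def)

lemmas psh_Tm = nat_trans_psh(1)[OF typ_of_nat_trans]
  and psh_Ty = nat_trans_psh(2)[OF typ_of_nat_trans]

lemmas comp_hom = category_comp[OF category]
  and ident_hom = category_ident[OF category]
  and hom_ob = category_hom_ob[OF category]
  and ident_left = category_ident_left[OF category]
  and ident_right = category_ident_right[OF category]
  and comp_assoc = category_assoc[OF category]
  and Ty_act = presheaf_act[OF psh_Ty]
  and Ty_ident = presheaf_ident[OF psh_Ty]
  and Ty_comp = presheaf_comp[OF psh_Ty]
  and Tm_act = presheaf_act[OF psh_Tm]
  and Tm_ident = presheaf_ident[OF psh_Tm]
  and Tm_comp = presheaf_comp[OF psh_Tm]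

lemma tmsD:
  assumes "a \<in> tms N G A"
  shows "a \<in> El (Tm N) G" "typ_of N G a = A"
  using assms by (auto simp: tms_def)

lemma tms_act:
  assumes "f \<in> hom C D G" "a \<in> tms N G A"
  shows "Act (Tm N) f a \<in> tms N D (Act (Ty N) f A)"
  using assms nat_trans_nat[OF typ_of_nat_trans] Tm_act by (auto simp: tms_def)

section \<open>Context extension and its universal property\<close>

lemma cext_ob: "G \<in> Ob C \<Longrightarrow> A \<in> El (Ty N) G \<Longrightarrow> cext N G A \<in> Ob C"
  and proj_hom: "G \<in> Ob C \<Longrightarrow> A \<in> El (Ty N) G \<Longrightarrow> proj N G A \<in> hom C (cext N G A) G"
  and var_el: "G \<in> Ob C \<Longrightarrow> A \<in> El (Ty N) G \<Longrightarrow> var N G A \<in> El (Tm N) (cext N G A)"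
  using natural_model by (auto simp: natural_model_def)

lemma cext_pullback:
  assumes "G \<in> Ob C" "A \<in> El (Ty N) G"
  shows "is_pullback U C (yo C (cext N G A)) (Tm N) (yo C G) (Ty N)
    (yo_el C (Tm N) (cext N G A) (var N G A)) (yo_arr C (proj N G A)) (typ_of N)
    (yo_el C (Ty N) G A)"
  using assms natural_model by (simp add: natural_model_def)

text \<open>Commutativity of the defining square, evaluated at the identity of
  \<open>cext N G A\<close>: one leg returns \<open>var N G A\<close>, the other
  \<open>proj N G A\<close>.\<close>

lemma var_tms:
  assumes G: "G \<in> Ob C" and A: "A \<in> El (Ty N) G"
  shows "var N G A \<in> tms N (cext N G A) (Act (Ty N) (proj N G A) A)"
proof -
  let ?X = "cext N G A" let ?i = "Ident C (cext N G A)"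
  note X = cext_ob[OF G A] and p = proj_hom[OF G A]
  note i = ident_hom[OF X]
  have "\<forall>X\<in>Ob C. \<forall>x\<in>El (yo C ?X) X. typ_of N X (yo_el C (Tm N) ?X (var N G A) X x) =
      yo_el C (Ty N) G A X (yo_arr C (proj N G A) X x)"
    using cext_pullback[OF G A] unfolding is_pullback_def nt_comp_eq_iff by blast
  from this[rule_format, OF X, of ?i] show ?thesis
    using X i p var_el[OF G A] homD[OF p]
    by (simp add: yo_def yo_el_def yo_arr_def tms_def Tm_ident ident_right)
qed

text \<open>The pointwise criterion at stage \<open>D\<close>: an element of the representable
  corner is a substitution into the extended context, and a matching pair is \<open>s\<close>
  together with a term of type \<open>A[s]\<close>. Hence the description in \<open>pairing\<close>
  is proper.\<close>

lemma pairing_ex1: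
  assumes s: "s \<in> hom C D G" and A: "A \<in> El (Ty N) G" and a: "a \<in> tms N D (Act (Ty N) s A)"
  shows "\<exists>!t. t \<in> hom C D (cext N G A) \<and> Comp C (proj N G A) t = s \<and> Act (Tm N) t (var N G A) = a"
proof -
  note ob = hom_ob[OF s]
  have "\<exists>!t. t \<in> El (yo C (cext N G A)) D \<and>
      yo_el C (Tm N) (cext N G A) (var N G A) D t = a \<and> yo_arr C (proj N G A) D t = s"
    by (rule is_pullback_pointwise_ex1[OF category cext_pullback[OF ob(2) A] ob(1)])
      (use s a ob in \<open>auto simp: yo_def yo_el_def tms_def\<close>)
  moreover have "(t \<in> El (yo C (cext N G A)) D \<and>
      yo_el C (Tm N) (cext N G A) (var N G A) D t = a \<and> yo_arr C (proj N G A) D t = s) \<longleftrightarrow>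
     (t \<in> hom C D (cext N G A) \<and> Comp C (proj N G A) t = s \<and> Act (Tm N) t (var N G A) = a)" for t
    using ob homD[OF proj_hom[OF ob(2) A]] by (auto simp: yo_def yo_el_def yo_arr_def)
  ultimately show ?thesis by simp
qed

lemma
  assumes "s \<in> hom C D G" "A \<in> El (Ty N) G" "a \<in> tms N D (Act (Ty N) s A)"
  shows pairing_hom: "pairing N A s a \<in> hom C D (cext N G A)"
    and proj_pairing: "Comp C (proj N G A) (pairing N A s a) = s"
    and var_pairing: "Act (Tm N) (pairing N A s a) (var N G A) = a"
  using theI'[OF pairing_ex1[OF assms]] homD[OF assms(1)] by (simp_all add: pairing_def)

text \<open>Both maps solve the problem of \<open>pairing_ex1\<close> for the same projection and
  the same term. The three laws of \<open>weaken\<close> below are all proved by this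
  comparison.\<close>

lemma cext_hom_eqI:
  assumes A: "A \<in> El (Ty N) G" and G: "G \<in> Ob C"
    and t: "t \<in> hom C D (cext N G A)" and t': "t' \<in> hom C D (cext N G A)"
    and "Comp C (proj N G A) t = Comp C (proj N G A) t'"
    and "Act (Tm N) t (var N G A) = Act (Tm N) t' (var N G A)"
  shows "t = t'"
proof -
  let ?s = "Comp C (proj N G A) t"
  have s: "?s \<in> hom C D G" using comp_hom[OF t proj_hom[OF G A]] .
  have "Act (Tm N) t (var N G A) \<in> tms N D (Act (Ty N) ?s A)"
    using tms_act[OF t var_tms[OF G A]] Ty_comp[OF t proj_hom[OF G A] A] by simp
  from pairing_ex1[OF s A this] show ?thesis using assms by metis
qed

lemma
  assumes a: "a \<in> tms N G A" and A: "A \<in> El (Ty N) G" and G: "G \<in> Ob C"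
  shows sect_hom: "sect N G a \<in> hom C G (cext N G A)"
    and proj_sect: "Comp C (proj N G A) (sect N G a) = Ident C G"
    and var_sect: "Act (Tm N) (sect N G a) (var N G A) = a"
proof -
  have "a \<in> tms N G (Act (Ty N) (Ident C G) A)" using a Ty_ident[OF G A] by simp
  note h = ident_hom[OF G] A this
  show "sect N G a \<in> hom C G (cext N G A)" "Comp C (proj N G A) (sect N G a) = Ident C G"
    "Act (Tm N) (sect N G a) (var N G A) = a"
    using pairing_hom[OF h] proj_pairing[OF h] var_pairing[OF h] tmsD(2)[OF a]
    by (simp_all add: sect_def)
qed

lemma
  assumes s: "s \<in> hom C D G" and A: "A \<in> El (Ty N) G"
  shows weaken_hom: "weaken N s A \<in> hom C (cext N D (Act (Ty N) s A)) (cext N G A)"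
    and proj_weaken: "Comp C (proj N G A) (weaken N s A) = Comp C s (proj N D (Act (Ty N) s A))"
    and var_weaken: "Act (Tm N) (weaken N s A) (var N G A) = var N D (Act (Ty N) s A)"
proof -
  let ?A = "Act (Ty N) s A"
  note ob = hom_ob[OF s]
  have A': "?A \<in> El (Ty N) D" using Ty_act[OF s A] .
  note p = proj_hom[OF ob(1) A']
  \<comment> \<open>\<open>var_tms\<close> gives the type \<open>A[s][p]\<close>, with
    \<open>p\<close> the projection over \<open>D\<close>; pairing along the composite of
    \<open>s\<close> and \<open>p\<close> needs it as one substitution.\<close>
  have "var N D ?A \<in> tms N (cext N D ?A) (Act (Ty N) (Comp C s (proj N D ?A)) A)"
    using var_tms[OF ob(1) A'] Ty_comp[OF p s A] by simp
  note h = comp_hom[OF p s] A this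
  show "weaken N s A \<in> hom C (cext N D (Act (Ty N) s A)) (cext N G A)"
    "Comp C (proj N G A) (weaken N s A) = Comp C s (proj N D (Act (Ty N) s A))"
    "Act (Tm N) (weaken N s A) (var N G A) = var N D (Act (Ty N) s A)"
    using pairing_hom[OF h] proj_pairing[OF h] var_pairing[OF h] homD[OF s]
    by (simp_all add: weaken_def Let_def)
qed

section \<open>Weakening: functoriality and compatibility with sections\<close>

lemma weaken_ident:
  assumes G: "G \<in> Ob C" and A: "A \<in> El (Ty N) G"
  shows "weaken N (Ident C G) A = Ident C (cext N G A)"
proof (rule cext_hom_eqI[OF A G])
  note i = ident_hom[OF G] and p = proj_hom[OF G A] and AI = Ty_ident[OF G A]
  show "weaken N (Ident C G) A \<in> hom C (cext N G A) (cext N G A)"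
    using weaken_hom[OF i A] AI by simp
  show "Ident C (cext N G A) \<in> hom C (cext N G A) (cext N G A)"
    using ident_hom[OF cext_ob[OF G A]] .
  show "Comp C (proj N G A) (weaken N (Ident C G) A) =
      Comp C (proj N G A) (Ident C (cext N G A))"
    using proj_weaken[OF i A] AI ident_left[OF p] ident_right[OF p] by simp
  show "Act (Tm N) (weaken N (Ident C G) A) (var N G A) =
      Act (Tm N) (Ident C (cext N G A)) (var N G A)"
    using var_weaken[OF i A] AI Tm_ident[OF cext_ob[OF G A] var_el[OF G A]] by simp
qed

text \<open>Both sides project to \<open>g\<close> after \<open>f\<close> after the projection, and
  both pull the variable back to the variable of \<open>A[g][f]\<close>. Their domains coincide
  because the action on types is strictly functorial.\<close>

lemma weaken_comp:
  assumes f: "f \<in> hom C E D" and g: "g \<in> hom C D G" and A: "A \<in> El (Ty N) G"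
  shows "weaken N (Comp C g f) A = Comp C (weaken N g A) (weaken N f (Act (Ty N) g A))"
proof (rule cext_hom_eqI[OF A hom_ob(2)[OF g]])
  let ?A = "Act (Ty N) g A" let ?A2 = "Act (Ty N) f ?A"
  have A': "?A \<in> El (Ty N) D" and A2: "?A2 \<in> El (Ty N) E"
    using Ty_act[OF g A] Ty_act[OF f] by auto
  note gf = comp_hom[OF f g] and AC = Ty_comp[OF f g A]
  note wf = weaken_hom[OF f A'] and wg = weaken_hom[OF g A]
  note pG = proj_hom[OF hom_ob(2)[OF g] A] and pD = proj_hom[OF hom_ob(1)[OF g] A']
    and pE = proj_hom[OF hom_ob(1)[OF f] A2]
  show "weaken N (Comp C g f) A \<in> hom C (cext N E ?A2) (cext N G A)"
    using weaken_hom[OF gf A] AC by simp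
  show "Comp C (weaken N g A) (weaken N f ?A) \<in> hom C (cext N E ?A2) (cext N G A)"
    using comp_hom[OF wf wg] .
  have "Comp C (proj N G A) (Comp C (weaken N g A) (weaken N f ?A)) =
      Comp C g (Comp C (proj N D ?A) (weaken N f ?A))"
    using comp_assoc[OF wf wg pG] proj_weaken[OF g A] comp_assoc[OF wf pD g] by simp
  then show "Comp C (proj N G A) (weaken N (Comp C g f) A) =
      Comp C (proj N G A) (Comp C (weaken N g A) (weaken N f ?A))"
    using proj_weaken[OF gf A] AC proj_weaken[OF f A'] comp_assoc[OF pE f g] by simp
  show "Act (Tm N) (weaken N (Comp C g f) A) (var N G A) =
      Act (Tm N) (Comp C (weaken N g A) (weaken N f ?A)) (var N G A)"
    using var_weaken[OF gf A] AC Tm_comp[OF wf wg var_el[OF hom_ob(2)[OF g] A]]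
      var_weaken[OF g A] var_weaken[OF f A'] by simp
qed

text \<open>Both sides are the map with projection \<open>f\<close> and variable
  \<open>a[f]\<close>. Applied to \<open>B\<close>, this makes the type of \<open>b[f]\<close> the
  one required of a fourth component over \<open>D\<close>.\<close>

lemma weaken_sect:
  assumes f: "f \<in> hom C D G" and A: "A \<in> El (Ty N) G" and a: "a \<in> tms N G A"
  shows "Comp C (weaken N f A) (sect N D (Act (Tm N) f a)) = Comp C (sect N G a) f"
proof (rule cext_hom_eqI[OF A hom_ob(2)[OF f]])
  let ?A = "Act (Ty N) f A" let ?a = "Act (Tm N) f a"
  note ob = hom_ob[OF f]
  have A': "?A \<in> El (Ty N) D" using Ty_act[OF f A] .
  note a' = tms_act[OF f a]
  note sa = sect_hom[OF a A ob(2)] and sa' = sect_hom[OF a' A' ob(1)] and w = weaken_hom[OF f A]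
  note p = proj_hom[OF ob(2) A] and p' = proj_hom[OF ob(1) A'] and v = var_el[OF ob(2) A]
  show "Comp C (weaken N f A) (sect N D ?a) \<in> hom C D (cext N G A)" using comp_hom[OF sa' w] .
  show "Comp C (sect N G a) f \<in> hom C D (cext N G A)" using comp_hom[OF f sa] .
  show "Comp C (proj N G A) (Comp C (weaken N f A) (sect N D ?a)) =
      Comp C (proj N G A) (Comp C (sect N G a) f)"
    using comp_assoc[OF sa' w p] comp_assoc[OF sa' p' f] comp_assoc[OF f sa p] proj_weaken[OF f A]
      proj_sect[OF a A ob(2)] proj_sect[OF a' A' ob(1)] ident_left[OF f] ident_right[OF f] by simp
  show "Act (Tm N) (Comp C (weaken N f A) (sect N D ?a)) (var N G A) =
      Act (Tm N) (Comp C (sect N G a) f) (var N G A)"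
    using Tm_comp[OF sa' w v] Tm_comp[OF f sa v] var_weaken[OF f A] var_sect[OF a A ob(2)]
      var_sect[OF a' A' ob(1)] by simp
qed

lemma Ty_act_sect:
  assumes "f \<in> hom C D G" "A \<in> El (Ty N) G" "a \<in> tms N G A" "B \<in> El (Ty N) (cext N G A)"
  shows "Act (Ty N) f (Act (Ty N) (sect N G a) B) =
    Act (Ty N) (sect N D (Act (Tm N) f a)) (Act (Ty N) (weaken N f A) B)"
proof -
  note ob = hom_ob[OF assms(1)]
  show ?thesis
    using Ty_comp[OF assms(1) sect_hom[OF assms(3,2) ob(2)] assms(4)]
      Ty_comp[OF sect_hom[OF tms_act[OF assms(1,3)] Ty_act[OF assms(1,2)] ob(1)]
        weaken_hom[OF assms(1,2)] assms(4)]
      weaken_sect[OF assms(1-3)] by simp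
qed

lemma Ty_act_weaken:
  assumes "f \<in> hom C D G" "A \<in> El (Ty N) G" "B \<in> El (Ty N) (cext N G A)"
  shows "Act (Ty N) (weaken N f A) B \<in> El (Ty N) (cext N D (Act (Ty N) f A))"
  using Ty_act[OF weaken_hom[OF assms(1,2)] assms(3)] .

lemma tms_act_sect:
  assumes "f \<in> hom C D G" "A \<in> El (Ty N) G" "B \<in> El (Ty N) (cext N G A)" "a \<in> tms N G A"
    "b \<in> tms N G (Act (Ty N) (sect N G a) B)"
  shows "Act (Tm N) f b \<in> tms N D
    (Act (Ty N) (sect N D (Act (Tm N) f a)) (Act (Ty N) (weaken N f A) B))"
  using tms_act[OF assms(1,5)] Ty_act_sect[OF assms(1,2,4,3)] by simp

lemma Ty_act_weaken_ident:
  assumes "G \<in> Ob C" "A \<in> El (Ty N) G" "B \<in> El (Ty N) (cext N G A)"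
  shows "Act (Ty N) (weaken N (Ident C G) A) B = B"
  using assms weaken_ident Ty_ident cext_ob by simp

lemma Ty_act_weaken_comp:
  assumes f: "f \<in> hom C E D" and g: "g \<in> hom C D G"
    and A: "A \<in> El (Ty N) G" and B: "B \<in> El (Ty N) (cext N G A)"
  shows "Act (Ty N) (weaken N (Comp C g f) A) B =
    Act (Ty N) (weaken N f (Act (Ty N) g A)) (Act (Ty N) (weaken N g A) B)"
  using weaken_comp[OF f g A] Ty_comp[OF weaken_hom[OF f Ty_act[OF g A]] weaken_hom[OF g A] B]
  by simp

section \<open>The two classifying presheaves and the projection between them\<close>

lemma El_form_iff [simp]:
  "(A, B) \<in> El (form_psh N) G \<longleftrightarrow> A \<in> El (Ty N) G \<and> B \<in> El (Ty N) (cext N G A)"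
  by (simp add: form_psh_def)

lemma Act_form [simp]:
  "Act (form_psh N) f (A, B) = (Act (Ty N) f A, Act (Ty N) (weaken N f A) B)"
  by (simp add: form_psh_def)

lemma El_intro_iff [simp]:
  "(A, B, a, b) \<in> El (intro_psh N) G \<longleftrightarrow>
    A \<in> El (Ty N) G \<and> B \<in> El (Ty N) (cext N G A) \<and>
    a \<in> tms N G A \<and> b \<in> tms N G (Act (Ty N) (sect N G a) B)"
  by (simp add: intro_psh_def)

lemma Act_intro [simp]:
  "Act (intro_psh N) f (A, B, a, b) =
    (Act (Ty N) f A, Act (Ty N) (weaken N f A) B, Act (Tm N) f a, Act (Tm N) f b)"
  by (simp add: intro_psh_def)

lemma presheaf_form: "presheaf C (form_psh N)"
proof (rule presheafI[OF category])
  fix D G f x assume "f \<in> hom C D G" "x \<in> El (form_psh N) G"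
  then show "Act (form_psh N) f x \<in> El (form_psh N) D"
    by (cases x) (simp add: Ty_act Ty_act_weaken)
next
  fix G x assume "G \<in> Ob C" "x \<in> El (form_psh N) G"
  then show "Act (form_psh N) (Ident C G) x = x"
    by (cases x) (simp add: Ty_ident Ty_act_weaken_ident)
next
  fix E D G f g x assume "f \<in> hom C E D" "g \<in> hom C D G" "x \<in> El (form_psh N) G"
  then show "Act (form_psh N) (Comp C g f) x = Act (form_psh N) f (Act (form_psh N) g x)"
    by (cases x) (simp add: Ty_comp Ty_act_weaken_comp)
qed

lemma presheaf_intro: "presheaf C (intro_psh N)"
proof (rule presheafI[OF category])
  fix D G f x assume "f \<in> hom C D G" "x \<in> El (intro_psh N) G"
  then show "Act (intro_psh N) f x \<in> El (intro_psh N) D"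
    by (cases x) (simp add: Ty_act Ty_act_weaken tms_act tms_act_sect)
next
  fix G x assume "G \<in> Ob C" "x \<in> El (intro_psh N) G"
  then show "Act (intro_psh N) (Ident C G) x = x"
    by (cases x) (auto simp: Ty_ident Ty_act_weaken_ident Tm_ident dest: tmsD)
next
  fix E D G f g x assume "f \<in> hom C E D" "g \<in> hom C D G" "x \<in> El (intro_psh N) G"
  then show "Act (intro_psh N) (Comp C g f) x = Act (intro_psh N) f (Act (intro_psh N) g x)"
    by (cases x) (auto simp: Ty_comp Ty_act_weaken_comp Tm_comp dest: tmsD)
qed

lemma intro_proj_apply [simp]:
  assumes "G \<in> Ob C" "(A, B, a, b) \<in> El (intro_psh N) G"
  shows "intro_proj N G (A, B, a, b) = (A, B)"
  using assms unfolding intro_proj_def by simp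

lemma nat_trans_intro_proj: "nat_trans C (intro_psh N) (form_psh N) (intro_proj N)"
proof (rule nat_transI[OF presheaf_intro presheaf_form])
  fix G x assume "G \<in> Ob C" "x \<in> El (intro_psh N) G"
  then show "intro_proj N G x \<in> El (form_psh N) G" by (cases x) auto
next
  fix D G f x assume f: "f \<in> hom C D G" and x: "x \<in> El (intro_psh N) G"
  then show "intro_proj N D (Act (intro_psh N) f x) = Act (form_psh N) f (intro_proj N G x)"
    using hom_ob[OF f] presheaf_act[OF presheaf_intro f x] by (cases x) (simp del: El_intro_iff)
qed (auto simp: intro_proj_def)

section \<open>Dependent sums\<close>

text \<open>The typing clause is commutativity of the square. Lying over \<open>(A, B)\<close> under
  \<open>intro_proj\<close> fixes the first two components of an element of
  \<open>intro_psh\<close>, so a unique lift is the same as a unique pair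
  \<open>(a, b)\<close>.\<close>

lemma sigma_square_iff:
  "sigma_square U N s q \<longleftrightarrow>
    nat_trans C (form_psh N) (Ty N) s \<and> nat_trans C (intro_psh N) (Tm N) q \<and>
    (\<forall>G\<in>Ob C. \<forall>A\<in>El (Ty N) G. \<forall>B\<in>El (Ty N) (cext N G A).
      (\<forall>a\<in>tms N G A. \<forall>b\<in>tms N G (Act (Ty N) (sect N G a) B).
        typ_of N G (q G (A, B, a, b)) = s G (A, B)) \<and>
      (\<forall>c\<in>tms N G (s G (A, B)). \<exists>!(a, b). a \<in> tms N G A \<and>
        b \<in> tms N G (Act (Ty N) (sect N G a) B) \<and> q G (A, B, a, b) = c))"
  (is "?L \<longleftrightarrow> ?R")
proof
  assume ?L
  then have nt: "nat_trans C (form_psh N) (Ty N) s" "nat_trans C (intro_psh N) (Tm N) q"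
    and pb: "is_pullback U C (intro_psh N) (Tm N) (form_psh N) (Ty N) q (intro_proj N) (typ_of N) s"
    by (auto simp: sigma_square_def)
  have comm: "\<forall>G\<in>Ob C. \<forall>x\<in>El (intro_psh N) G. typ_of N G (q G x) = s G (intro_proj N G x)"
    using pb unfolding is_pullback_def nt_comp_eq_iff by blast
  have q_typ: "typ_of N G (q G (A, B, a, b)) = s G (A, B)"
    if "G \<in> Ob C" "A \<in> El (Ty N) G" "B \<in> El (Ty N) (cext N G A)" "a \<in> tms N G A"
      "b \<in> tms N G (Act (Ty N) (sect N G a) B)" for G A B a b
    using comm that intro_proj_apply[of G A B a b] by fastforce
  have "\<exists>!(a, b). a \<in> tms N G A \<and> b \<in> tms N G (Act (Ty N) (sect N G a) B) \<and> q G (A, B, a, b) = c"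
    if G: "G \<in> Ob C" and AB: "A \<in> El (Ty N) G" "B \<in> El (Ty N) (cext N G A)"
      and c: "c \<in> tms N G (s G (A, B))" for G A B c
  proof -
    have ex1: "\<exists>!x. x \<in> El (intro_psh N) G \<and> q G x = c \<and> intro_proj N G x = (A, B)"
      by (rule is_pullback_pointwise_ex1[OF category pb G]) (use AB tmsD[OF c] in auto)
    then obtain A' B' a b where "(A', B', a, b) \<in> El (intro_psh N) G" "q G (A', B', a, b) = c"
      "intro_proj N G (A', B', a, b) = (A, B)" by (metis prod_cases4)
    then have ab: "a \<in> tms N G A" "b \<in> tms N G (Act (Ty N) (sect N G a) B)" "q G (A, B, a, b) = c"
      using G by auto
    show ?thesis
    proof (rule ex1I[of _ "(a, b)"])
      show "case (a, b) of (a, b) \<Rightarrow> a \<in> tms N G A \<and>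
          b \<in> tms N G (Act (Ty N) (sect N G a) B) \<and> q G (A, B, a, b) = c"
        using ab by simp
      fix y assume "case y of (a, b) \<Rightarrow> a \<in> tms N G A \<and>
          b \<in> tms N G (Act (Ty N) (sect N G a) B) \<and> q G (A, B, a, b) = c"
      then obtain a' b' where y: "y = (a', b')" "a' \<in> tms N G A"
        "b' \<in> tms N G (Act (Ty N) (sect N G a') B)" "q G (A, B, a', b') = c" by auto
      \<comment> \<open>With \<open>A\<close> and \<open>B\<close> put in front, the two pairs
        become two lifts of the same matching pair, to which the uniqueness of lifts
        applies.\<close>
      have "(A, B, a, b) = (A, B, a', b')"
        by (rule ex1_unique[OF ex1]) (use ab y AB G in auto)
      then show "y = (a, b)" using y by simp
    qed
  qed
  with nt q_typ show ?R by blast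
next
  assume R: ?R
  then have nt: "nat_trans C (form_psh N) (Ty N) s" "nat_trans C (intro_psh N) (Tm N) q" by auto
  have "is_pullback U C (intro_psh N) (Tm N) (form_psh N) (Ty N) q (intro_proj N) (typ_of N) s"
  proof (rule is_pullbackI[OF category nt(2) nat_trans_intro_proj typ_of_nat_trans nt(1)])
    fix G x assume G: "G \<in> Ob C" and x: "x \<in> El (intro_psh N) G"
    obtain A B a b where "x = (A, B, a, b)" by (metis prod_cases4)
    then show "typ_of N G (q G x) = s G (intro_proj N G x)" using G x R by auto
  next
    fix G c y assume G: "G \<in> Ob C" and c: "c \<in> El (Tm N) G" and y: "y \<in> El (form_psh N) G"
      and eq: "typ_of N G c = s G y"
    obtain A B where AB: "y = (A, B)" by (cases y)
    have c': "c \<in> tms N G (s G (A, B))" using c eq AB by (simp add: tms_def)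
    have ex1: "\<exists>!(a, b). a \<in> tms N G A \<and> b \<in> tms N G (Act (Ty N) (sect N G a) B) \<and>
        q G (A, B, a, b) = c"
      using R G y AB c' by auto
    then obtain a b where ab: "a \<in> tms N G A" "b \<in> tms N G (Act (Ty N) (sect N G a) B)"
      "q G (A, B, a, b) = c" by auto
    show "\<exists>!x. x \<in> El (intro_psh N) G \<and> q G x = c \<and> intro_proj N G x = y"
    proof (rule ex1I[of _ "(A, B, a, b)"])
      show "(A, B, a, b) \<in> El (intro_psh N) G \<and> q G (A, B, a, b) = c \<and>
          intro_proj N G (A, B, a, b) = y"
        using ab G y AB by auto
      fix x assume x: "x \<in> El (intro_psh N) G \<and> q G x = c \<and> intro_proj N G x = y"
      obtain A' B' a' b' where x': "x = (A', B', a', b')" by (metis prod_cases4)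
      then have AB': "A' = A" "B' = B" using x G AB by auto
      have "(a, b) = (a', b')"
        by (rule ex1_unique[OF ex1]) (use ab x x' AB' in auto)
      then show "x = (A, B, a, b)" using x' AB' by simp
    qed
  qed
  then show ?L using nt natural_model by (simp add: sigma_square_def)
qed

text \<open>The memberships are kept whole, since comparing two models needs their extensionality as
  well as the typing of values.\<close>

lemma sigma_model_PiE:
  assumes "sigma_model U N S"
  shows "sg S \<in> (\<Pi>\<^sub>E G\<in>Ob C. \<Pi>\<^sub>E A\<in>El (Ty N) G. \<Pi>\<^sub>E B\<in>El (Ty N) (cext N G A). El (Ty N) G)"
    and "pr S \<in> (\<Pi>\<^sub>E G\<in>Ob C. \<Pi>\<^sub>E A\<in>El (Ty N) G. \<Pi>\<^sub>E B\<in>El (Ty N) (cext N G A).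
      \<Pi>\<^sub>E a\<in>tms N G A. \<Pi>\<^sub>E b\<in>tms N G (Act (Ty N) (sect N G a) B). tms N G (sg S G A B))"
    and "first S \<in> (\<Pi>\<^sub>E G\<in>Ob C. \<Pi>\<^sub>E A\<in>El (Ty N) G. \<Pi>\<^sub>E B\<in>El (Ty N) (cext N G A).
      \<Pi>\<^sub>E c\<in>tms N G (sg S G A B). tms N G A)"
    and "second S \<in> (\<Pi>\<^sub>E G\<in>Ob C. \<Pi>\<^sub>E A\<in>El (Ty N) G. \<Pi>\<^sub>E B\<in>El (Ty N) (cext N G A).
      \<Pi>\<^sub>E c\<in>tms N G (sg S G A B). tms N G (Act (Ty N) (sect N G (first S G A B c)) B))"
  by (insert assms, unfold sigma_model_def, (elim conjE, assumption)+)

lemma sigma_modelD: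
  assumes S: "sigma_model U N S"
    and G: "G \<in> Ob C" and A: "A \<in> El (Ty N) G" and B: "B \<in> El (Ty N) (cext N G A)"
  shows sg_el: "sg S G A B \<in> El (Ty N) G"
    and pr_tms: "\<lbrakk>a \<in> tms N G A; b \<in> tms N G (Act (Ty N) (sect N G a) B)\<rbrakk> \<Longrightarrow>
      pr S G A B a b \<in> tms N G (sg S G A B)"
    and first_tms: "c \<in> tms N G (sg S G A B) \<Longrightarrow> first S G A B c \<in> tms N G A"
    and second_tms: "c \<in> tms N G (sg S G A B) \<Longrightarrow>
      second S G A B c \<in> tms N G (Act (Ty N) (sect N G (first S G A B c)) B)"
    and sg_act: "f \<in> hom C D G \<Longrightarrow>
      Act (Ty N) f (sg S G A B) = sg S D (Act (Ty N) f A) (Act (Ty N) (weaken N f A) B)"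
    and pr_act: "\<lbrakk>f \<in> hom C D G; a \<in> tms N G A; b \<in> tms N G (Act (Ty N) (sect N G a) B)\<rbrakk> \<Longrightarrow>
      Act (Tm N) f (pr S G A B a b) = pr S D (Act (Ty N) f A) (Act (Ty N) (weaken N f A) B)
        (Act (Tm N) f a) (Act (Tm N) f b)"
    and first_pr: "\<lbrakk>a \<in> tms N G A; b \<in> tms N G (Act (Ty N) (sect N G a) B)\<rbrakk> \<Longrightarrow>
      first S G A B (pr S G A B a b) = a"
    and second_pr: "\<lbrakk>a \<in> tms N G A; b \<in> tms N G (Act (Ty N) (sect N G a) B)\<rbrakk> \<Longrightarrow>
      second S G A B (pr S G A B a b) = b"
    and pr_first_second: "c \<in> tms N G (sg S G A B) \<Longrightarrow>
      pr S G A B (first S G A B c) (second S G A B c) = c"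
proof -
  note S' = S[unfolded sigma_model_def Let_def] and ops = sigma_model_PiE[OF S]
  show "sg S G A B \<in> El (Ty N) G"
    using PiE3_mem[OF ops(1) G A B] .
  show "pr S G A B a b \<in> tms N G (sg S G A B)"
    if "a \<in> tms N G A" "b \<in> tms N G (Act (Ty N) (sect N G a) B)"
    using PiE_mem[OF PiE_mem[OF PiE3_mem[OF ops(2) G A B] that(1)] that(2)] .
  show "first S G A B c \<in> tms N G A" if "c \<in> tms N G (sg S G A B)"
    using PiE_mem[OF PiE3_mem[OF ops(3) G A B] that] .
  show "second S G A B c \<in> tms N G (Act (Ty N) (sect N G (first S G A B c)) B)"
    if "c \<in> tms N G (sg S G A B)"
    using PiE_mem[OF PiE3_mem[OF ops(4) G A B] that] .
  show "Act (Ty N) f (sg S G A B) = sg S D (Act (Ty N) f A) (Act (Ty N) (weaken N f A) B)"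
    if "f \<in> hom C D G"
    using S' G A B that hom_ob[OF that] by simp
  show "Act (Tm N) f (pr S G A B a b) = pr S D (Act (Ty N) f A) (Act (Ty N) (weaken N f A) B)
        (Act (Tm N) f a) (Act (Tm N) f b)"
    if "f \<in> hom C D G" "a \<in> tms N G A" "b \<in> tms N G (Act (Ty N) (sect N G a) B)"
    using S' G A B that hom_ob[OF that(1)] by simp
qed (use S[unfolded sigma_model_def Let_def] G A B in simp_all)

section \<open>From operations to a pullback square, and back\<close>

lemma sigma_hat_apply [simp]:
  assumes "G \<in> Ob C" "A \<in> El (Ty N) G" "B \<in> El (Ty N) (cext N G A)"
  shows "sigma_hat N S G (A, B) = sg S G A B"
  using assms by (simp add: sigma_hat_def)

lemma pair_hat_apply [simp]:
  assumes "G \<in> Ob C" "A \<in> El (Ty N) G" "B \<in> El (Ty N) (cext N G A)"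
    "a \<in> tms N G A" "b \<in> tms N G (Act (Ty N) (sect N G a) B)"
  shows "pair_hat N S G (A, B, a, b) = pr S G A B a b"
  using assms by (simp add: pair_hat_def)

lemma sigma_square_hat:
  assumes S: "sigma_model U N S"
  shows "sigma_square U N (sigma_hat N S) (pair_hat N S)"
  unfolding sigma_square_iff
proof (intro conjI ballI)
  show "nat_trans C (form_psh N) (Ty N) (sigma_hat N S)"
  proof (rule nat_transI[OF presheaf_form psh_Ty])
    fix G x assume "G \<in> Ob C" "x \<in> El (form_psh N) G"
    then show "sigma_hat N S G x \<in> El (Ty N) G" by (cases x) (simp add: sg_el[OF S])
  next
    fix D G f x assume f: "f \<in> hom C D G" and "x \<in> El (form_psh N) G"
    then show "sigma_hat N S D (Act (form_psh N) f x) = Act (Ty N) f (sigma_hat N S G x)"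
      using hom_ob[OF f] by (cases x) (simp add: sg_act[OF S] Ty_act Ty_act_weaken)
  qed (auto simp: sigma_hat_def)
  show "nat_trans C (intro_psh N) (Tm N) (pair_hat N S)"
  proof (rule nat_transI[OF presheaf_intro psh_Tm])
    fix G x assume "G \<in> Ob C" "x \<in> El (intro_psh N) G"
    then show "pair_hat N S G x \<in> El (Tm N) G"
      by (cases x) (simp add: tmsD(1)[OF pr_tms[OF S]])
  next
    fix D G f x assume f: "f \<in> hom C D G" and "x \<in> El (intro_psh N) G"
    then show "pair_hat N S D (Act (intro_psh N) f x) = Act (Tm N) f (pair_hat N S G x)"
      using hom_ob[OF f]
      by (cases x) (simp add: pr_act[OF S] Ty_act Ty_act_weaken tms_act tms_act_sect)
  qed (auto simp: pair_hat_def)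
next
  fix G A B a b
  assume "G \<in> Ob C" "A \<in> El (Ty N) G" "B \<in> El (Ty N) (cext N G A)" "a \<in> tms N G A"
    "b \<in> tms N G (Act (Ty N) (sect N G a) B)"
  then show "typ_of N G (pair_hat N S G (A, B, a, b)) = sigma_hat N S G (A, B)"
    by (simp add: tmsD(2)[OF pr_tms[OF S]])
next
  fix G A B c
  assume G: "G \<in> Ob C" "A \<in> El (Ty N) G" "B \<in> El (Ty N) (cext N G A)"
    and "c \<in> tms N G (sigma_hat N S G (A, B))"
  then have c: "c \<in> tms N G (sg S G A B)" by simp
  show "\<exists>!(a, b). a \<in> tms N G A \<and> b \<in> tms N G (Act (Ty N) (sect N G a) B) \<and>
      pair_hat N S G (A, B, a, b) = c"
    \<comment> \<open>The surjective pairing equation makes this a solution; the two projection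
      equations applied to any other solution show that it is the same.\<close>
    by (rule ex1I[of _ "(first S G A B c, second S G A B c)"])
      (use G c first_tms[OF S G c] second_tms[OF S G c] pr_first_second[OF S G c]
        in \<open>auto simp: first_pr[OF S G] second_pr[OF S G]\<close>)
qed

lemma sigma_model_eqI:
  assumes S: "sigma_model U N S" and S': "sigma_model U N S'"
    and sig: "sigma_hat N S = sigma_hat N S'" and pair: "pair_hat N S = pair_hat N S'"
  shows "S = S'"
proof -
  have sg: "sg S G A B = sg S' G A B"
    if "G \<in> Ob C" "A \<in> El (Ty N) G" "B \<in> El (Ty N) (cext N G A)" for G A B
    using sigma_hat_apply[OF that] sig by metis
  have pr: "pr S G A B a b = pr S' G A B a b"
    if "G \<in> Ob C" "A \<in> El (Ty N) G" "B \<in> El (Ty N) (cext N G A)"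
      "a \<in> tms N G A" "b \<in> tms N G (Act (Ty N) (sect N G a) B)" for G A B a b
    using pair_hat_apply[OF that] pair by metis
  have fs: "first S G A B c = first S' G A B c \<and> second S G A B c = second S' G A B c"
    if G: "G \<in> Ob C" "A \<in> El (Ty N) G" "B \<in> El (Ty N) (cext N G A)"
      and c: "c \<in> tms N G (sg S G A B)" for G A B c
  proof -
    note ab = first_tms[OF S G c] second_tms[OF S G c]
    \<comment> \<open>The projections of \<open>S\<close> exhibit \<open>c\<close> as a pair, and
      \<open>S'\<close> forms the same pair; projecting in \<open>S'\<close> then returns the same
      components.\<close>
    have "pr S' G A B (first S G A B c) (second S G A B c) = c"
      using pr[OF G ab] pr_first_second[OF S G c] by simp
    then show ?thesis using first_pr[OF S' G ab] second_pr[OF S' G ab] by simp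
  qed
  note ops = sigma_model_PiE[OF S] and ops' = sigma_model_PiE[OF S']
  have sg_eq: "sg S = sg S'"
    by (rule PiE3_eqI[OF ops(1) ops'(1) sg])
  \<comment> \<open>Extensional comparison needs both operations in one function space, so
    \<open>sg S'\<close> is first replaced by \<open>sg S\<close>; for \<open>second\<close>,
    \<open>first S'\<close> has to be replaced as well.\<close>
  note pr' = ops'(2)[folded sg_eq]
  have pr_eq: "pr S = pr S'"
  proof (rule PiE3_eqI[OF ops(2) pr'])
    fix G A B assume G: "G \<in> Ob C" "A \<in> El (Ty N) G" "B \<in> El (Ty N) (cext N G A)"
    note F = PiE3_mem[OF ops(2) G] PiE3_mem[OF pr' G]
    show "pr S G A B = pr S' G A B"
    proof (rule PiE_ext[OF F])
      fix a assume a: "a \<in> tms N G A"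
      show "pr S G A B a = pr S' G A B a"
        by (rule PiE_ext[OF PiE_mem[OF F(1) a] PiE_mem[OF F(2) a] pr[OF G a]])
    qed
  qed
  note first' = ops'(3)[folded sg_eq]
  have first_eq: "first S = first S'"
  proof (rule PiE3_eqI[OF ops(3) first'])
    fix G A B assume G: "G \<in> Ob C" "A \<in> El (Ty N) G" "B \<in> El (Ty N) (cext N G A)"
    show "first S G A B = first S' G A B"
      by (rule PiE_ext[OF PiE3_mem[OF ops(3) G] PiE3_mem[OF first' G]]) (simp add: fs[OF G])
  qed
  note second' = ops'(4)[folded sg_eq first_eq]
  have "second S = second S'"
  proof (rule PiE3_eqI[OF ops(4) second'])
    fix G A B assume G: "G \<in> Ob C" "A \<in> El (Ty N) G" "B \<in> El (Ty N) (cext N G A)"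
    show "second S G A B = second S' G A B"
      by (rule PiE_ext[OF PiE3_mem[OF ops(4) G] PiE3_mem[OF second' G]]) (simp add: fs[OF G])
  qed
  then show ?thesis using sg_eq pr_eq first_eq by simp
qed

text \<open>By \<open>P_ex\<close> every term of the sum type is a value of \<open>q\<close>, so the
  equations for \<open>first\<close> and \<open>second\<close> need checking only on values of
  \<open>q\<close>, where \<open>S_simps\<close> returns the components.\<close>

lemma sigma_model_of_square:
  assumes sq: "sigma_square U N s q"
  obtains S where "sigma_model U N S" "sigma_hat N S = s" "pair_hat N S = q"
proof -
  note R = sq[unfolded sigma_square_iff]
  have nt: "nat_trans C (form_psh N) (Ty N) s" "nat_trans C (intro_psh N) (Tm N) q"
    using R by blast+
  define P where "P G A B c = (THE (a, b). a \<in> tms N G A \<and>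
    b \<in> tms N G (Act (Ty N) (sect N G a) B) \<and> q G (A, B, a, b) = c)" for G A B c
  define S where "S = \<lparr>
    sg = (\<lambda>G\<in>Ob C. \<lambda>A\<in>El (Ty N) G. \<lambda>B\<in>El (Ty N) (cext N G A). s G (A, B)),
    pr = (\<lambda>G\<in>Ob C. \<lambda>A\<in>El (Ty N) G. \<lambda>B\<in>El (Ty N) (cext N G A). \<lambda>a\<in>tms N G A.
      \<lambda>b\<in>tms N G (Act (Ty N) (sect N G a) B). q G (A, B, a, b)),
    first = (\<lambda>G\<in>Ob C. \<lambda>A\<in>El (Ty N) G. \<lambda>B\<in>El (Ty N) (cext N G A). \<lambda>c\<in>tms N G (s G (A, B)).
      fst (P G A B c)),
    second = (\<lambda>G\<in>Ob C. \<lambda>A\<in>El (Ty N) G. \<lambda>B\<in>El (Ty N) (cext N G A). \<lambda>c\<in>tms N G (s G (A, B)).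
      snd (P G A B c))\<rparr>"
  have s_el: "s G (A, B) \<in> El (Ty N) G"
    if "G \<in> Ob C" "A \<in> El (Ty N) G" "B \<in> El (Ty N) (cext N G A)" for G A B
    using nat_trans_mem[OF nt(1)] that by simp
  have s_act: "Act (Ty N) f (s G (A, B)) = s D (Act (Ty N) f A, Act (Ty N) (weaken N f A) B)"
    if "f \<in> hom C D G" "A \<in> El (Ty N) G" "B \<in> El (Ty N) (cext N G A)" for f D G A B
    using nat_trans_nat[OF nt(1) that(1), of "(A, B)"] that by simp
  have q_act: "Act (Tm N) f (q G (A, B, a, b)) =
      q D (Act (Ty N) f A, Act (Ty N) (weaken N f A) B, Act (Tm N) f a, Act (Tm N) f b)"
    if "f \<in> hom C D G" "A \<in> El (Ty N) G" "B \<in> El (Ty N) (cext N G A)"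
      "a \<in> tms N G A" "b \<in> tms N G (Act (Ty N) (sect N G a) B)" for f D G A B a b
    using nat_trans_nat[OF nt(2) that(1), of "(A, B, a, b)"] that by simp
  have q_tms: "q G (A, B, a, b) \<in> tms N G (s G (A, B))"
    if "G \<in> Ob C" "A \<in> El (Ty N) G" "B \<in> El (Ty N) (cext N G A)"
      "a \<in> tms N G A" "b \<in> tms N G (Act (Ty N) (sect N G a) B)" for G A B a b
    using nat_trans_mem[OF nt(2) that(1), of "(A, B, a, b)"] R that by (simp add: tms_def)
  have P_eq: "P G A B (q G (A, B, a, b)) = (a, b)"
    if G: "G \<in> Ob C" "A \<in> El (Ty N) G" "B \<in> El (Ty N) (cext N G A)"
      and ab: "a \<in> tms N G A" "b \<in> tms N G (Act (Ty N) (sect N G a) B)" for G A B a b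
  proof -
    have "\<exists>!(a', b'). a' \<in> tms N G A \<and> b' \<in> tms N G (Act (Ty N) (sect N G a') B) \<and>
        q G (A, B, a', b') = q G (A, B, a, b)"
      using R G q_tms[OF G ab] by blast
    then show ?thesis unfolding P_def by (rule the1_equality) (use ab in simp)
  qed
  have P_ex: "\<exists>a b. a \<in> tms N G A \<and> b \<in> tms N G (Act (Ty N) (sect N G a) B) \<and>
      c = q G (A, B, a, b)"
    if "G \<in> Ob C" "A \<in> El (Ty N) G" "B \<in> El (Ty N) (cext N G A)" "c \<in> tms N G (s G (A, B))"
    for G A B c
  proof -
    have "\<exists>!(a, b). a \<in> tms N G A \<and> b \<in> tms N G (Act (Ty N) (sect N G a) B) \<and>
        q G (A, B, a, b) = c"
      using R that by blast
    then show ?thesis by auto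
  qed
  have S_simps:
    "\<And>G A B. \<lbrakk>G \<in> Ob C; A \<in> El (Ty N) G; B \<in> El (Ty N) (cext N G A)\<rbrakk> \<Longrightarrow> sg S G A B = s G (A, B)"
    "\<And>G A B a b. \<lbrakk>G \<in> Ob C; A \<in> El (Ty N) G; B \<in> El (Ty N) (cext N G A); a \<in> tms N G A;
      b \<in> tms N G (Act (Ty N) (sect N G a) B)\<rbrakk> \<Longrightarrow> pr S G A B a b = q G (A, B, a, b)"
    "\<And>G A B a b. \<lbrakk>G \<in> Ob C; A \<in> El (Ty N) G; B \<in> El (Ty N) (cext N G A); a \<in> tms N G A;
      b \<in> tms N G (Act (Ty N) (sect N G a) B)\<rbrakk> \<Longrightarrow> first S G A B (q G (A, B, a, b)) = a"
    "\<And>G A B a b. \<lbrakk>G \<in> Ob C; A \<in> El (Ty N) G; B \<in> El (Ty N) (cext N G A); a \<in> tms N G A;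
      b \<in> tms N G (Act (Ty N) (sect N G a) B)\<rbrakk> \<Longrightarrow> second S G A B (q G (A, B, a, b)) = b"
    by (simp_all add: S_def P_eq q_tms)
  have S_first: "first S G A B c = fst (P G A B c)"
    if "G \<in> Ob C" "A \<in> El (Ty N) G" "B \<in> El (Ty N) (cext N G A)" "c \<in> tms N G (s G (A, B))"
    for G A B c
    using that by (simp add: S_def)
  have P_tms: "fst (P G A B c) \<in> tms N G A"
    "snd (P G A B c) \<in> tms N G (Act (Ty N) (sect N G (fst (P G A B c))) B)"
    if "G \<in> Ob C" "A \<in> El (Ty N) G" "B \<in> El (Ty N) (cext N G A)" "c \<in> tms N G (s G (A, B))"
    for G A B c
    using P_ex[OF that] P_eq[OF that(1-3)] by auto
  have "sigma_model U N S"
    unfolding sigma_model_def Let_def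
  proof (intro conjI ballI)
    show "natural_model U N" by (fact natural_model)
    show "sg S \<in> (\<Pi>\<^sub>E G\<in>Ob C. \<Pi>\<^sub>E A\<in>El (Ty N) G. \<Pi>\<^sub>E B\<in>El (Ty N) (cext N G A). El (Ty N) G)"
      by (simp add: S_def s_el)
    show "pr S \<in> (\<Pi>\<^sub>E G\<in>Ob C. \<Pi>\<^sub>E A\<in>El (Ty N) G. \<Pi>\<^sub>E B\<in>El (Ty N) (cext N G A).
       \<Pi>\<^sub>E a\<in>tms N G A. \<Pi>\<^sub>E b\<in>tms N G (Act (Ty N) (sect N G a) B). tms N G (sg S G A B))"
      by (simp add: S_def q_tms)
    \<comment> \<open>The definition of \<open>S\<close> states this domain through
      \<open>s\<close>, the theory through \<open>sg S\<close>. They are known to agree for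
      arguments in range, so the exchange uses congruence of the dependent products.\<close>
    have "first S \<in> (\<Pi>\<^sub>E G\<in>Ob C. \<Pi>\<^sub>E A\<in>El (Ty N) G. \<Pi>\<^sub>E B\<in>El (Ty N) (cext N G A).
       \<Pi>\<^sub>E c\<in>tms N G (s G (A, B)). tms N G A)"
      by (simp add: S_def P_tms)
    then show "first S \<in> (\<Pi>\<^sub>E G\<in>Ob C. \<Pi>\<^sub>E A\<in>El (Ty N) G. \<Pi>\<^sub>E B\<in>El (Ty N) (cext N G A).
       \<Pi>\<^sub>E c\<in>tms N G (sg S G A B). tms N G A)"
      by (rule back_subst[where P="\<lambda>F. _ \<in> F"]) (intro PiE_cong, simp add: S_simps)
    have "second S \<in> (\<Pi>\<^sub>E G\<in>Ob C. \<Pi>\<^sub>E A\<in>El (Ty N) G. \<Pi>\<^sub>E B\<in>El (Ty N) (cext N G A).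
       \<Pi>\<^sub>E c\<in>tms N G (s G (A, B)). tms N G (Act (Ty N) (sect N G (fst (P G A B c))) B))"
      by (simp add: S_def P_tms)
    then show "second S \<in> (\<Pi>\<^sub>E G\<in>Ob C. \<Pi>\<^sub>E A\<in>El (Ty N) G. \<Pi>\<^sub>E B\<in>El (Ty N) (cext N G A).
       \<Pi>\<^sub>E c\<in>tms N G (sg S G A B). tms N G (Act (Ty N) (sect N G (first S G A B c)) B))"
      by (rule back_subst[where P="\<lambda>F. _ \<in> F"]) (intro PiE_cong, simp add: S_simps, rule PiE_cong, simp add: S_first)
  next
    fix D G f A B
    assume f: "f \<in> hom C D G" and G: "G \<in> Ob C" and D: "D \<in> Ob C"
      and AB: "A \<in> El (Ty N) G" "B \<in> El (Ty N) (cext N G A)"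
    let ?A = "Act (Ty N) f A" let ?B = "Act (Ty N) (weaken N f A) B"
    note DAB = D Ty_act[OF f AB(1)] Ty_act_weaken[OF f AB]
    show "Act (Ty N) f (sg S G A B) = sg S D ?A ?B"
      using DAB G AB by (simp add: S_simps s_act[OF f])
    fix a b assume ab: "a \<in> tms N G A" "b \<in> tms N G (Act (Ty N) (sect N G a) B)"
    show "Act (Tm N) f (pr S G A B a b) = pr S D ?A ?B (Act (Tm N) f a) (Act (Tm N) f b)"
      using DAB G AB ab by (simp add: S_simps q_act[OF f] tms_act[OF f] tms_act_sect[OF f])
  next
    fix D G f A B c
    assume f: "f \<in> hom C D G" and G: "G \<in> Ob C" and D: "D \<in> Ob C"
      and AB: "A \<in> El (Ty N) G" "B \<in> El (Ty N) (cext N G A)"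
      and "c \<in> tms N G (sg S G A B)"
    let ?A = "Act (Ty N) f A" let ?B = "Act (Ty N) (weaken N f A) B"
    note DAB = D Ty_act[OF f AB(1)] Ty_act_weaken[OF f AB]
    have "c \<in> tms N G (s G (A, B))" using \<open>c \<in> _\<close> S_simps(1)[OF G AB] by simp
    then obtain a b where ab: "a \<in> tms N G A" "b \<in> tms N G (Act (Ty N) (sect N G a) B)"
      "c = q G (A, B, a, b)" using P_ex G AB by blast
    \<comment> \<open>Since \<open>c\<close> is \<open>q\<close> of \<open>a\<close> and
      \<open>b\<close>, naturality makes \<open>c[f]\<close> the value of \<open>q\<close> at
      \<open>a[f]\<close> and \<open>b[f]\<close>, whose components are known.\<close>
    show "Act (Tm N) f (first S G A B c) = first S D ?A ?B (Act (Tm N) f c)"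
      "Act (Tm N) f (second S G A B c) = second S D ?A ?B (Act (Tm N) f c)"
      using DAB G AB ab by (simp_all add: S_simps q_act[OF f] tms_act[OF f] tms_act_sect[OF f])
  next
    fix G A B a b
    assume "G \<in> Ob C" "A \<in> El (Ty N) G" "B \<in> El (Ty N) (cext N G A)" "a \<in> tms N G A"
      "b \<in> tms N G (Act (Ty N) (sect N G a) B)"
    then show "first S G A B (pr S G A B a b) = a" "second S G A B (pr S G A B a b) = b"
      by (simp_all add: S_simps)
  next
    fix G A B c
    assume G: "G \<in> Ob C" and AB: "A \<in> El (Ty N) G" "B \<in> El (Ty N) (cext N G A)"
      and "c \<in> tms N G (sg S G A B)"
    then have "c \<in> tms N G (s G (A, B))" using S_simps(1)[OF G AB] by simp
    then obtain a b where "a \<in> tms N G A" "b \<in> tms N G (Act (Ty N) (sect N G a) B)"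
      "c = q G (A, B, a, b)" using P_ex G AB by blast
    then show "pr S G A B (first S G A B c) (second S G A B c) = c"
      using G AB by (simp add: S_simps)
  qed
  \<comment> \<open>Both sides are natural transformations, the left one by
    \<open>sigma_square_hat\<close> for the model just built, so agreement on elements
    suffices.\<close>
  moreover have "sigma_hat N S = s"
  proof (rule nat_trans_eqI[OF _ nt(1)])
    show "nat_trans C (form_psh N) (Ty N) (sigma_hat N S)"
      using sigma_square_hat[OF calculation] by (simp add: sigma_square_def)
    fix G x assume "G \<in> Ob C" "x \<in> El (form_psh N) G"
    then show "sigma_hat N S G x = s G x" by (cases x) (simp add: S_simps)
  qed
  moreover have "pair_hat N S = q"
  proof (rule nat_trans_eqI[OF _ nt(2)])
    show "nat_trans C (intro_psh N) (Tm N) (pair_hat N S)"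
      using sigma_square_hat[OF calculation(1)] by (simp add: sigma_square_def)
    fix G x assume "G \<in> Ob C" "x \<in> El (intro_psh N) G"
    then show "pair_hat N S G x = q G x" by (cases x) (simp add: S_simps)
  qed
  ultimately show thesis using that by blast
qed

end

text \<open>\<open>N\<close> is part of the data on both sides and is left fixed, so the claim
  reduces to a bijection for each natural model.\<close>

theorem theorem2p2p11:
  shows "bij_betw (\<lambda>(N, S). (N, sigma_hat N S, pair_hat N S))
    {(N :: ('o, 'm, 'ty, 'tm) nmodel, S). sigma_model TYPE('u) N S}
    {(N, s, q). sigma_square TYPE('u) N s q}"
proof -
  \<comment> \<open>Either kind of structure includes the natural model itself; the disjunction lets
    one fact serve both directions.\<close>
  have loc: "nat_model TYPE('u) N"
    if "sigma_model TYPE('u) N S \<or> sigma_square TYPE('u) N s q"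
    for N :: "('o, 'm, 'ty, 'tm) nmodel" and S s q
    using that by unfold_locales (auto simp: sigma_model_def sigma_square_def)
  show ?thesis
    unfolding bij_betw_def
  proof (intro conjI subset_antisym subsetI)
    show "inj_on (\<lambda>(N, S). (N, sigma_hat N S, pair_hat N S))
        {(N :: ('o, 'm, 'ty, 'tm) nmodel, S). sigma_model TYPE('u) N S}"
      by (auto simp: inj_on_def intro: nat_model.sigma_model_eqI[OF loc])
  next
    fix y assume "y \<in> (\<lambda>(N, S). (N, sigma_hat N S, pair_hat N S)) `
        {(N :: ('o, 'm, 'ty, 'tm) nmodel, S). sigma_model TYPE('u) N S}"
    then show "y \<in> {(N, s, q). sigma_square TYPE('u) N s q}"
      using nat_model.sigma_square_hat[OF loc] by fastforce
  next
    fix y assume "y \<in> {(N :: ('o, 'm, 'ty, 'tm) nmodel, s, q). sigma_square TYPE('u) N s q}"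
    then obtain N s q where y: "y = (N, s, q)" "sigma_square TYPE('u) N s q" by auto
    then obtain S where "sigma_model TYPE('u) N S" "sigma_hat N S = s" "pair_hat N S = q"
      using nat_model.sigma_model_of_square[OF loc] by metis
    then show "y \<in> (\<lambda>(N, S). (N, sigma_hat N S, pair_hat N S)) `
        {(N, S). sigma_model TYPE('u) N S}"
      using y(1) by force
  qed
qed

end
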